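(* Let $d\ge3$, let $p\in[2,\infty)$, and let $B\in L^p(\Omega;\mathbb{R}^d)$ satisfy $\mathbb{E}[B]=0$, $D\cdot B=0$ and, for some $R\in(0,\infty)$, for every $A_1,A_2\subseteq\mathbb{R}^d$, the sigma algebras $$\sigma(B(\tau_x\omega):x\in A_1)\quad\text{and}\quad\sigma(B(\tau_x\omega):x\in A_2)$$ are independent whenever $\mathrm{dist}(A_1,A_2)\ge R$. Then there exists a skew-symmetric matrix $S=(S_{jk})_{j,k\in\{1,\dots,d\}}\in L^p(\Omega;\mathbb{R}^{d\times d})$ that satisfies $$D\cdot S=B\ \text{ in } L^p(\Omega;\mathbb{R}^d).$$
   Context: $(\Omega,\mathcal{F},\mathbb{P})$ is a probability space with expectation $\mathbb{E}$ and a jointly measurable measure-preserving transformation group $\{\tau_x:\Omega\to\Omega\}_{x\in\mathbb{R}^d}$ ($\tau_{x+y}=\tau_x\tau_y$, $\tau_0=\mathrm{id}$), which is ergodic: for $g\in L^\infty(\Omega)$, $g(\omega)=g(\tau_x\omega)$ almost surely for every $x\in\mathbb{R}^d$ if and only if $g$ is almost surely constant. The environment also carries a measurable $A:\Omega\to\mathbb{R}^{d\times d}$ for which there are $\lambda,\Lambda\in(0,\infty)$ with, almost surely for every $\xi\in\mathbb{R}^d$, $|A\xi|\le\Lambda|\xi|$ and $A\xi\cdot\xi\ge\lambda|\xi|^2$. Horizontal derivatives. For $i\in\{1,\dots,d\}$, $D_if=\lim_{h\to0}(f(\tau_{he_i}\cdot)-f)/h$, with domain the set of $f\in L^2(\Omega)$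 for which this limit exists strongly in $L^2(\Omega)$. $\mathcal{D}(\Omega)$ is the space of functions $\omega\mapsto\int_{\mathbb{R}^d}f(\tau_x\omega)\psi(x)\,dx$ with $\psi\in C_c^\infty(\mathbb{R}^d)$, $f\in L^\infty(\Omega)$. Derivatives are understood distributionally by testing against $\psi\in\mathcal{D}(\Omega)$: $D_if$ acts by $-\mathbb{E}[fD_i\psi]$. For a vector field $V$, $D\cdot V=\sum_iD_iV_i$; for a matrix field $S$, $(D\cdot S)_j=\sum_kD_kS_{jk}$. $\mathrm{dist}(A_1,A_2)$ is the Euclidean distance between the sets. *)

theory Defs
  imports "HOL-Probability.Probability"
begin

text \<open>Elements of the Lebesgue spaces are represented by actual functions, not by classes
  modulo almost sure equality. Matrices carry the norm of
  \<^typ>\<open>real ^ 'n ^ 'n\<close>, which is the Frobenius norm.\<close>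

definition Lp :: "'a measure \<Rightarrow> real \<Rightarrow> ('a \<Rightarrow> 'b::{real_normed_vector, second_countable_topology}) set"
  where "Lp M p = {f \<in> borel_measurable M. integrable M (\<lambda>\<omega>. norm (f \<omega>) powr p)}"

definition Linfty :: "'a measure \<Rightarrow> ('a \<Rightarrow> 'b::{real_normed_vector, second_countable_topology}) set"
  where "Linfty M = {f \<in> borel_measurable M. \<exists>C. AE \<omega> in M. norm (f \<omega>) \<le> C}"

locale random_environment = prob_space M
  for M :: "'a measure"
    and \<tau> :: "real ^ 'n::finite \<Rightarrow> 'a \<Rightarrow> 'a"
    and A :: "'a \<Rightarrow> real ^ 'n ^ 'n" +
  assumes tau_measurable: "(\<lambda>(x, \<omega>). \<tau> x \<omega>) \<in> measurable (borel \<Otimes>\<^sub>M M) M"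
    and tau_preserving: "\<And>x. distr M M (\<tau> x) = M"
    and tau_add: "\<And>x y \<omega>. \<omega> \<in> space M \<Longrightarrow> \<tau> (x + y) \<omega> = \<tau> x (\<tau> y \<omega>)"
    and tau_zero: "\<And>\<omega>. \<omega> \<in> space M \<Longrightarrow> \<tau> 0 \<omega> = \<omega>"
    and ergodic: "\<And>g :: 'a \<Rightarrow> real. g \<in> Linfty M \<Longrightarrow>
      (\<forall>x. AE \<omega> in M. g \<omega> = g (\<tau> x \<omega>)) \<longleftrightarrow> (\<exists>c. AE \<omega> in M. g \<omega> = c)"
    and A_measurable: "A \<in> borel_measurable M"
    and A_elliptic: "\<exists>lam Lam. 0 < lam \<and> 0 < Lam \<and>
      (AE \<omega> in M. \<forall>\<xi>. norm (A \<omega> *v \<xi>) \<le> Lam * norm \<xi> \<and> (A \<omega> *v \<xi>) \<bullet> \<xi> \<ge> lam * (norm \<xi>)\<^sup>2)"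

primrec Ck :: "nat \<Rightarrow> (real ^ 'n::finite \<Rightarrow> real) \<Rightarrow> bool" where
  "Ck 0 \<phi> \<longleftrightarrow> continuous_on UNIV \<phi>"
| "Ck (Suc k) \<phi> \<longleftrightarrow> \<phi> differentiable_on UNIV \<and>
     (\<forall>i. Ck k (\<lambda>x. frechet_derivative \<phi> (at x) (axis i 1)))"

definition Cc_infinity :: "(real ^ 'n::finite \<Rightarrow> real) set"
  where "Cc_infinity = {\<phi>. (\<forall>k. Ck k \<phi>) \<and> compact (closure {x. \<phi> x \<noteq> 0})}"

definition test_functions :: "'a measure \<Rightarrow> (real ^ 'n::finite \<Rightarrow> 'a \<Rightarrow> 'a) \<Rightarrow> ('a \<Rightarrow> real) set"
  where "test_functions M \<tau> =
    {(\<lambda>\<omega>. LINT x|lborel. f (\<tau> x \<omega>) * \<phi> x) | f \<phi>. f \<in> Linfty M \<and> \<phi> \<in> Cc_infinity}"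

definition has_horizontal_derivative ::
  "'a measure \<Rightarrow> (real ^ 'n::finite \<Rightarrow> 'a \<Rightarrow> 'a) \<Rightarrow> 'n \<Rightarrow> ('a \<Rightarrow> real) \<Rightarrow> ('a \<Rightarrow> real) \<Rightarrow> bool"
  where "has_horizontal_derivative M \<tau> i f g \<longleftrightarrow> f \<in> Lp M 2 \<and> g \<in> Lp M 2 \<and>
    ((\<lambda>h. LINT \<omega>|M. ((f (\<tau> (h *\<^sub>R axis i 1) \<omega>) - f \<omega>) / h - g \<omega>)\<^sup>2) \<longlongrightarrow> 0) (at 0)"

text \<open>The strong limit is unique up to almost sure equality; the choice of a representative does
  not affect the expectations below. Outside its domain the operator is unspecified, but it is only
  applied to test functions, which belong to the domain.\<close>

definition horizontal_derivative ::
  "'a measure \<Rightarrow> (real ^ 'n::finite \<Rightarrow> 'a \<Rightarrow> 'a) \<Rightarrow> 'n \<Rightarrow> ('a \<Rightarrow> real) \<Rightarrow> ('a \<Rightarrow> real)"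
  where "horizontal_derivative M \<tau> i f = (SOME g. has_horizontal_derivative M \<tau> i f g)"

text \<open>Distributions are functionals, of which only the values on
  \<^term>\<open>test_functions M \<tau>\<close> matter.\<close>

definition dist_derivative ::
  "'a measure \<Rightarrow> (real ^ 'n::finite \<Rightarrow> 'a \<Rightarrow> 'a) \<Rightarrow> 'n \<Rightarrow> ('a \<Rightarrow> real) \<Rightarrow> ('a \<Rightarrow> real) \<Rightarrow> real"
  where "dist_derivative M \<tau> i f \<psi> = - (LINT \<omega>|M. f \<omega> * horizontal_derivative M \<tau> i \<psi> \<omega>)"

definition divergence ::
  "'a measure \<Rightarrow> (real ^ 'n::finite \<Rightarrow> 'a \<Rightarrow> 'a) \<Rightarrow> ('a \<Rightarrow> real ^ 'n) \<Rightarrow> ('a \<Rightarrow> real) \<Rightarrow> real"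
  where "divergence M \<tau> V \<psi> = (\<Sum>i\<in>UNIV. dist_derivative M \<tau> i (\<lambda>\<omega>. V \<omega> $ i) \<psi>)"

definition matrix_divergence ::
  "'a measure \<Rightarrow> (real ^ 'n::finite \<Rightarrow> 'a \<Rightarrow> 'a) \<Rightarrow> ('a \<Rightarrow> real ^ 'n ^ 'n) \<Rightarrow> 'n \<Rightarrow> ('a \<Rightarrow> real) \<Rightarrow> real"
  where "matrix_divergence M \<tau> S j \<psi> = (\<Sum>k\<in>UNIV. dist_derivative M \<tau> k (\<lambda>\<omega>. S \<omega> $ j $ k) \<psi>)"

definition sigma_field_on ::
  "'a measure \<Rightarrow> (real ^ 'n::finite \<Rightarrow> 'a \<Rightarrow> 'a) \<Rightarrow> ('a \<Rightarrow> real ^ 'n) \<Rightarrow> (real ^ 'n) set \<Rightarrow> 'a set set"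
  where "sigma_field_on M \<tau> B U =
    sigma_sets (space M) {(\<lambda>\<omega>. B (\<tau> x \<omega>)) -` E \<inter> space M | x E. x \<in> U \<and> E \<in> sets borel}"

text \<open>\<^const>\<open>setdist\<close> is 0, rather than infinite, if one of the sets is empty.
  This is harmless: the sigma algebra of the empty set is trivial, hence independent of every
  other one.\<close>

definition finite_range_dependence ::
  "'a measure \<Rightarrow> (real ^ 'n::finite \<Rightarrow> 'a \<Rightarrow> 'a) \<Rightarrow> ('a \<Rightarrow> real ^ 'n) \<Rightarrow> real \<Rightarrow> bool"
  where "finite_range_dependence M \<tau> B R \<longleftrightarrow> (\<forall>A1 A2. setdist A1 A2 \<ge> R \<longrightarrow>
    prob_space.indep_set M (sigma_field_on M \<tau> B A1) (sigma_field_on M \<tau> B A2))"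

end

theory Submission
  imports Defs
begin

text \<open>The stream matrix is built from averages of the field over growing boxes of lattice points.
  Let \<open>P m\<close> be the boxes with \<open>P 0 = {0}\<close> and \<open>P (m + 1) = P m \<union> (P m + L m e\<^sub>i)\<close>, where the
  coordinate direction \<open>i\<close> runs cyclically through the \<open>d\<close> directions and \<open>L m = R 2^(m div d)\<close>
  is the current side length; \<open>P m\<close> has \<open>2 ^ m\<close> points at mutual distance at least \<open>R\<close>.
  For a test function \<open>\<psi>\<close> put \<open>g x = E[B\<^sub>j(\<tau> x \<omega>) \<psi>(\<omega>)]\<close>, and let \<open>A m g\<close> be the average of \<open>g\<close> over
  \<open>P m\<close>. Then \<open>A 0 g = E[B\<^sub>j \<psi>]\<close>, while \<open>A m g\<close> tends to 0 by decorrelation, and by stationarity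
  \<open>A m g - A (m + 1) g = - \<integral> (L m / 2) A m (\<partial>\<^sub>i g)(\<cdot> + s (L m) e\<^sub>i) ds, s \<in> [0, 1]\<close>
  with \<open>\<partial>\<^sub>i g x = - E[B\<^sub>j(\<tau> x \<omega>) D\<^sub>i \<psi>(\<omega>)]\<close>. So \<open>L m / 2\<close> times the average of \<open>B\<^sub>j\<close>
  over the region swept by \<open>P m\<close> along the segment is, up to sign, the entry \<open>(j, i)\<close> of a matrix
  whose divergence, tested against \<open>\<psi>\<close>, is the \<open>m\<close>-th decrement of the averages.
  Adding the same entry with \<open>j\<close> and \<open>k\<close> exchanged makes it skew-symmetric and costs nothing, since
  \<open>B\<close> is divergence free and hence \<open>\<Sum>\<^sub>k E[B\<^sub>k(\<tau> x \<omega>) D\<^sub>k \<psi>(\<omega>)] = 0\<close>. The stream matrix is the sum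
  over \<open>m\<close> of these matrices (lemmas \<open>inc_divergence\<close> and \<open>stream_matrix_divergence\<close>).

  The sum converges in \<open>L\<^sup>p\<close>. The values of \<open>B\<close> at \<open>R\<close>-separated points are independent with mean
  zero, so the \<open>p\<close>-th moment of a sum of \<open>N\<close> of them is at most \<open>(K N)^(p / 2) E|B|^p\<close>: for
  independent \<open>X\<close>, \<open>Y\<close> with \<open>E Y = 0\<close> the first-order term of \<open>|X + Y|^p\<close> has mean zero, and induction
  on \<open>N\<close> applies (\<open>moment_indep_add\<close>, \<open>moment_sum_separated\<close>). Averages over \<open>P m\<close> therefore have
  \<open>L\<^sup>p\<close> norm of order \<open>2^(-m / 2)\<close>, and the \<open>m\<close>-th matrix is of order \<open>L m 2^(-m / 2)\<close>, that is
  \<open>2^(m / d - m / 2)\<close>, which is summable precisely because \<open>d \<ge> 3\<close> (\<open>edge_decay\<close>, \<open>moment_series\<close>).\<close>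

section \<open>Elementary inequalities for powers\<close>

lemma powr_diff_mvt:
  fixes a b q :: real
  assumes "0 < a" "0 < b"
  obtains c where "min a b \<le> c" "c \<le> max a b" "b powr q - a powr q = (b - a) * (q * c powr (q - 1))"
proof (cases a b rule: linorder_cases)
  case less
  have "\<exists>z>a. z < b \<and> b powr q - a powr q = (b - a) * (q * z powr (q - 1))"
    by (rule MVT2[OF less]) (use assms in \<open>auto intro!: derivative_eq_intros\<close>)
  then show ?thesis using less that by (metis less_imp_le max.absorb4 min.absorb3)
next
  case equal
  then show ?thesis using that[of a] by simp
next
  case greater
  have "\<exists>z>b. z < a \<and> a powr q - b powr q = (a - b) * (q * z powr (q - 1))"
    by (rule MVT2[OF greater]) (use assms in \<open>auto intro!: derivative_eq_intros\<close>)
  then obtain z where z: "z > b" "z < a" "a powr q - b powr q = (a - b) * (q * z powr (q - 1))" by blast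
  have "b powr q - a powr q = (b - a) * (q * z powr (q - 1))"
    using z(3) by (simp add: algebra_simps)
  then show ?thesis using z greater that by (metis less_imp_le max.absorb3 min.absorb4)
qed

text \<open>A constant for which the second-order expansion of \<open>|x + y|^p\<close> in \<open>powr_add_le_taylor\<close> holds.\<close>

definition taylor_const :: "real \<Rightarrow> real"
  where "taylor_const p = 2 powr p * p\<^sup>2"

lemma powr_add_le_taylor_pos:
  fixes x y p :: real
  assumes p: "p \<ge> 2" and x: "x > 0" and y: "\<bar>y\<bar> < x"
  shows "(x + y) powr p \<le> x powr p + p * x powr (p - 1) * y + taylor_const p * (x powr (p - 2) * y\<^sup>2)"
proof -
  have xy: "x + y > 0" using y by linarith
  obtain c where c: "min x (x + y) \<le> c" "c \<le> max x (x + y)"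
      "(x + y) powr p - x powr p = y * (p * c powr (p - 1))"
    using powr_diff_mvt[OF x xy, of p] by auto
  have c0: "c > 0" using c(1) x xy by linarith
  obtain e where e: "min x c \<le> e" "e \<le> max x c"
      "c powr (p - 1) - x powr (p - 1) = (c - x) * ((p - 1) * e powr (p - 2))"
    using powr_diff_mvt[OF x c0, of "p - 1"] by (auto simp: diff_diff_eq)
  have e0: "e > 0" using e(1) x c0 by linarith
  have e2: "e \<le> 2 * x" using e(2) c(2) y by linarith
  have cx: "\<bar>c - x\<bar> \<le> \<bar>y\<bar>" using c by linarith
  have pw: "e powr (p - 2) \<le> 2 powr p * x powr (p - 2)"
  proof -
    have "e powr (p - 2) \<le> (2 * x) powr (p - 2)"
      using e0 e2 p by (intro powr_mono2) auto
    also have "\<dots> = 2 powr (p - 2) * x powr (p - 2)"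
      using x by (simp add: powr_mult)
    also have "\<dots> \<le> 2 powr p * x powr (p - 2)"
      by (intro mult_right_mono powr_mono) auto
    finally show ?thesis .
  qed
  have "y * (c - x) \<le> \<bar>y\<bar> * \<bar>c - x\<bar>" by (metis abs_ge_self abs_mult)
  also have "\<dots> \<le> \<bar>y\<bar> * \<bar>y\<bar>" using cx by (intro mult_left_mono) auto
  finally have ycx: "y * (c - x) \<le> y\<^sup>2" by (simp add: power2_eq_square)
  have "(x + y) powr p - x powr p - p * x powr (p - 1) * y
      = p * y * (c powr (p - 1) - x powr (p - 1))"
    using c(3) by (simp add: algebra_simps)
  also have "\<dots> = (p * (p - 1)) * e powr (p - 2) * (y * (c - x))"
    unfolding e(3) by (simp add: algebra_simps)
  also have "\<dots> \<le> (p * (p - 1)) * e powr (p - 2) * y\<^sup>2"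
    using p ycx by (intro mult_left_mono) auto
  also have "\<dots> \<le> (p * (p - 1)) * (2 powr p * x powr (p - 2)) * y\<^sup>2"
    using p pw by (intro mult_right_mono mult_left_mono) auto
  also have "\<dots> \<le> p\<^sup>2 * (2 powr p * x powr (p - 2)) * y\<^sup>2"
    using p by (intro mult_right_mono) (auto simp: power2_eq_square)
  finally show ?thesis by (simp add: taylor_const_def algebra_simps)
qed

text \<open>The first-order term is linear in \<open>y\<close>; it drops out in expectation when \<open>y\<close> is replaced by an
  independent centred random variable.\<close>

lemma powr_add_le_taylor:
  fixes x y p :: real
  assumes p: "p \<ge> 2"
  shows "\<bar>x + y\<bar> powr p \<le> \<bar>x\<bar> powr p + p * (sgn x * \<bar>x\<bar> powr (p - 1)) * y
           + taylor_const p * (\<bar>x\<bar> powr (p - 2) * y\<^sup>2 + \<bar>y\<bar> powr p)"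
proof (cases "\<bar>y\<bar> < \<bar>x\<bar>")
  case True
  have C: "0 \<le> taylor_const p * \<bar>y\<bar> powr p" by (simp add: taylor_const_def)
  show ?thesis
  proof (cases "x > 0")
    case xpos: True
    then have "x + y > 0" using True by linarith
    then show ?thesis
      using powr_add_le_taylor_pos[OF p xpos, of y] xpos True C by (simp add: algebra_simps)
  next
    case False
    then have xneg: "- x > 0" "\<bar>- y\<bar> < - x" using True by auto
    then have "\<bar>x + y\<bar> = - x + - y" by linarith
    then show ?thesis
      using powr_add_le_taylor_pos[OF p xneg] xneg(1) C by (simp add: algebra_simps)
  qed
next
  case False
  then have le: "\<bar>x\<bar> \<le> \<bar>y\<bar>" by simp
  have "\<bar>x + y\<bar> powr p \<le> (2 * \<bar>y\<bar>) powr p"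
    using p le by (intro powr_mono2) auto
  also have "\<dots> = 2 powr p * \<bar>y\<bar> powr p" by (simp add: powr_mult)
  finally have 1: "\<bar>x + y\<bar> powr p \<le> 2 powr p * \<bar>y\<bar> powr p" .
  have "\<bar>sgn x * \<bar>x\<bar> powr (p - 1) * y\<bar> \<le> \<bar>y\<bar> powr (p - 1) * \<bar>y\<bar>"
    using le p by (auto simp: abs_mult sgn_if intro!: mult_right_mono powr_mono2)
  also have "\<dots> = \<bar>y\<bar> powr p"
    using p by (cases "y = 0") (auto simp: powr_mult_base mult.commute)
  finally have 2: "\<bar>sgn x * \<bar>x\<bar> powr (p - 1) * y\<bar> \<le> \<bar>y\<bar> powr p" .
  have "p * (- (sgn x * \<bar>x\<bar> powr (p - 1) * y)) \<le> p * \<bar>y\<bar> powr p"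
    using 2 p by (intro mult_left_mono) auto
  moreover have "2 powr p + p \<le> taylor_const p"
  proof -
    have "2 * p \<le> p * p" by (rule mult_right_mono) (use p in auto)
    then have "p \<le> p\<^sup>2 - 1" using p unfolding power2_eq_square by linarith
    also have "p\<^sup>2 - 1 \<le> 2 powr p * (p\<^sup>2 - 1)"
      using p \<open>p \<le> p\<^sup>2 - 1\<close> ge_one_powr_ge_zero[of 2 p] mult_right_mono[of 1 "2 powr p" "p\<^sup>2 - 1"] by auto
    finally show ?thesis by (simp add: taylor_const_def algebra_simps)
  qed
  then have "(2 powr p + p) * \<bar>y\<bar> powr p \<le> taylor_const p * \<bar>y\<bar> powr p"
    by (intro mult_right_mono) auto
  moreover have "0 \<le> taylor_const p * (\<bar>x\<bar> powr (p - 2) * y\<^sup>2)" by (simp add: taylor_const_def)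
  moreover have "0 \<le> \<bar>x\<bar> powr p" by simp
  ultimately show ?thesis using 1
    unfolding distrib_left distrib_right mult.assoc mult_minus_right by linarith
qed

lemma powr_mult_square_le:
  fixes u v p :: real
  assumes p: "p \<ge> 2"
  shows "\<bar>u\<bar> powr (p - 2) * v\<^sup>2 \<le> \<bar>u\<bar> powr p + \<bar>v\<bar> powr p"
proof -
  define w where "w = max \<bar>u\<bar> \<bar>v\<bar>"
  have "\<bar>u\<bar> powr (p - 2) * v\<^sup>2 \<le> w powr (p - 2) * w\<^sup>2"
    using p by (intro mult_mono powr_mono2) (auto simp: w_def simp flip: abs_le_square_iff)
  also have "\<dots> = w powr p"
  proof (cases "w = 0")
    case False
    then have "w > 0" by (auto simp: w_def)
    then show ?thesis
      using powr_add[of w "p - 2" 2] by (simp add: powr_numeral)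
  qed auto
  also have "\<dots> \<le> \<bar>u\<bar> powr p + \<bar>v\<bar> powr p"
    by (auto simp: w_def max_def)
  finally show ?thesis .
qed

section \<open>Integrability of powers\<close>

lemma abs_le_one_plus_powr:
  fixes x p :: real
  assumes "p \<ge> q" "q > 0"
  shows "\<bar>x\<bar> powr q \<le> 1 + \<bar>x\<bar> powr p"
proof (cases "\<bar>x\<bar> \<le> 1")
  case True
  then have "\<bar>x\<bar> powr q \<le> 1" using assms by (simp add: powr_le1)
  then show ?thesis by (smt (verit) powr_ge_zero)
next
  case False
  then have "\<bar>x\<bar> powr q \<le> \<bar>x\<bar> powr p" using assms by (intro powr_mono) auto
  then show ?thesis by simp
qed

lemma integrable_powr_lower:
  fixes f :: "'a \<Rightarrow> real"
  assumes "prob_space M" "f \<in> borel_measurable M" "integrable M (\<lambda>x. \<bar>f x\<bar> powr p)" "p \<ge> q" "q > 0"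
  shows "integrable M (\<lambda>x. \<bar>f x\<bar> powr q)"
proof -
  interpret prob_space M by fact
  show ?thesis
    by (rule Bochner_Integration.integrable_bound[of M "\<lambda>x. 1 + \<bar>f x\<bar> powr p"])
       (use assms abs_le_one_plus_powr[OF assms(4,5)] in auto)
qed

lemma integrable_of_powr:
  fixes f :: "'a \<Rightarrow> real"
  assumes "prob_space M" "f \<in> borel_measurable M" "integrable M (\<lambda>x. \<bar>f x\<bar> powr p)" "p \<ge> 1"
  shows "integrable M f"
  using integrable_powr_lower[OF assms(1-3), of 1] assms(2,4) by (simp add: integrable_abs_iff)

lemma integrable_square_of_powr:
  fixes f :: "'a \<Rightarrow> real"
  assumes "prob_space M" "f \<in> borel_measurable M" "integrable M (\<lambda>x. \<bar>f x\<bar> powr p)" "p \<ge> 2"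
  shows "integrable M (\<lambda>x. (f x)\<^sup>2)"
  using integrable_powr_lower[OF assms(1-3), of 2] assms(4) by (simp add: powr_numeral)

lemma integrable_mult_of_squares:
  fixes f g :: "'a \<Rightarrow> real"
  assumes [measurable]: "f \<in> borel_measurable M" "g \<in> borel_measurable M"
    and "integrable M (\<lambda>x. (f x)\<^sup>2)" "integrable M (\<lambda>x. (g x)\<^sup>2)"
  shows "integrable M (\<lambda>x. f x * g x)"
proof (rule Bochner_Integration.integrable_bound[of M "\<lambda>x. (f x)\<^sup>2 + (g x)\<^sup>2"])
  have "\<bar>a * b\<bar> \<le> a\<^sup>2 + b\<^sup>2" for a b :: real
  proof -
    have "2 * \<bar>a * b\<bar> \<le> a\<^sup>2 + b\<^sup>2" using sum_squares_bound[of "\<bar>a\<bar>" "\<bar>b\<bar>"] by (simp add: abs_mult)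
    then show ?thesis by linarith
  qed
  then show "AE x in M. norm (f x * g x) \<le> norm ((f x)\<^sup>2 + (g x)\<^sup>2)"
    by auto
qed (use assms in auto)

text \<open>A form of Jensen's inequality. The constant \<open>2 powr p\<close> allows an elementary proof: if
  \<open>I\<close> is the \<open>p\<close>-th moment and \<open>l = I^(1/p)\<close>, then \<open>|t| \<le> l + l^(1 - p) |t|^p\<close> pointwise.\<close>

lemma powr_integral_le:
  fixes f :: "'a \<Rightarrow> real"
  assumes "prob_space M" and [measurable]: "f \<in> borel_measurable M"
    and int: "integrable M (\<lambda>x. \<bar>f x\<bar> powr p)" and p: "p \<ge> 1"
  shows "\<bar>LINT x|M. f x\<bar> powr p \<le> 2 powr p * (LINT x|M. \<bar>f x\<bar> powr p)"
proof -
  interpret prob_space M by fact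
  define I where "I = (LINT x|M. \<bar>f x\<bar> powr p)"
  have I0: "I \<ge> 0" by (simp add: I_def)
  have intf: "integrable M f" using integrable_of_powr[OF assms] .
  show ?thesis
  proof (cases "I = 0")
    case True
    then have "AE x in M. \<bar>f x\<bar> powr p = 0"
      unfolding I_def using int by (subst (asm) integral_nonneg_eq_0_iff_AE) auto
    then have "(LINT x|M. f x) = (LINT x|M. 0)" by (intro integral_cong_AE) auto
    then show ?thesis using I0 p by (simp flip: I_def)
  next
    case False
    then have I: "I > 0" using I0 by simp
    define l where "l = I powr (1 / p)"
    have l: "l > 0" "l powr p = I" using I p by (auto simp: l_def powr_powr)
    have pt: "\<bar>t\<bar> \<le> l + l powr (1 - p) * \<bar>t\<bar> powr p" for t :: real
    proof (cases "\<bar>t\<bar> \<le> l")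
      case True
      then show ?thesis by (smt (verit) mult_nonneg_nonneg powr_ge_zero)
    next
      case False
      then have t: "\<bar>t\<bar> > 0" "l \<le> \<bar>t\<bar>" using l by auto
      have "\<bar>t\<bar> = \<bar>t\<bar> powr (1 - p) * \<bar>t\<bar> powr p" using t by (simp flip: powr_add)
      also have "\<dots> \<le> l powr (1 - p) * \<bar>t\<bar> powr p"
        using t l p by (intro mult_right_mono powr_mono2') auto
      finally show ?thesis using l by linarith
    qed
    have "\<bar>LINT x|M. f x\<bar> \<le> (LINT x|M. \<bar>f x\<bar>)" by (rule integral_abs_bound)
    also have "\<dots> \<le> (LINT x|M. l + l powr (1 - p) * \<bar>f x\<bar> powr p)"
      using pt int intf by (intro integral_mono) auto
    also have "\<dots> = l + l powr (1 - p) * l powr p"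
      using int by (simp add: prob_space flip: I_def l(2))
    also have "\<dots> = 2 * l" using l(1) by (simp flip: powr_add)
    finally have "\<bar>LINT x|M. f x\<bar> powr p \<le> (2 * l) powr p"
      using p by (intro powr_mono2) auto
    then show ?thesis using l by (simp add: powr_mult I_def)
  qed
qed

lemma powr_add_le:
  fixes x y p :: real
  assumes "p \<ge> 0"
  shows "\<bar>x + y\<bar> powr p \<le> 2 powr p * (\<bar>x\<bar> powr p + \<bar>y\<bar> powr p)"
proof -
  have "\<bar>x + y\<bar> powr p \<le> (2 * max \<bar>x\<bar> \<bar>y\<bar>) powr p"
    using assms by (intro powr_mono2) auto
  also have "\<dots> = 2 powr p * (max \<bar>x\<bar> \<bar>y\<bar>) powr p"
    by (simp add: powr_mult)
  also have "\<dots> \<le> 2 powr p * (\<bar>x\<bar> powr p + \<bar>y\<bar> powr p)"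
    by (intro mult_left_mono) (auto simp: max_def)
  finally show ?thesis .
qed

lemma integrable_powr_add:
  fixes f g :: "'a \<Rightarrow> real"
  assumes [measurable]: "f \<in> borel_measurable M" "g \<in> borel_measurable M"
    and int: "integrable M (\<lambda>x. \<bar>f x\<bar> powr p)" "integrable M (\<lambda>x. \<bar>g x\<bar> powr p)" and p: "p \<ge> 0"
  shows "integrable M (\<lambda>x. \<bar>f x + g x\<bar> powr p)"
  by (rule Bochner_Integration.integrable_bound[of M "\<lambda>x. 2 powr p * (\<bar>f x\<bar> powr p + \<bar>g x\<bar> powr p)"])
     (use int powr_add_le[OF p] in auto)

section \<open>Moments of sums over separated points\<close>

lemma borel_measurable_vec_nth [measurable (raw)]:
  fixes f :: "'a \<Rightarrow> real ^ 'n"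
  assumes "f \<in> borel_measurable M"
  shows "(\<lambda>x. f x $ j) \<in> borel_measurable M"
proof -
  have "(\<lambda>x. f x \<bullet> axis j 1) \<in> borel_measurable M" using assms by measurable
  then show ?thesis by (simp add: inner_axis)
qed

context random_environment
begin

lemma measurable_tau [measurable (raw)]:
  assumes "X \<in> borel_measurable N" "Y \<in> measurable N M"
  shows "(\<lambda>z. \<tau> (X z) (Y z)) \<in> measurable N M"
  using measurable_compose[OF measurable_Pair[OF assms] tau_measurable] by simp

lemma integral_tau:
  fixes f :: "'a \<Rightarrow> 'b::{banach, second_countable_topology}"
  assumes [measurable]: "f \<in> borel_measurable M"
  shows "(LINT \<omega>|M. f (\<tau> x \<omega>)) = (LINT \<omega>|M. f \<omega>)"
  using integral_distr[of "\<tau> x" M M f] by (simp add: tau_preserving)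

lemma integrable_tau:
  fixes f :: "'a \<Rightarrow> 'b::{banach, second_countable_topology}"
  assumes [measurable]: "f \<in> borel_measurable M"
  shows "integrable M (\<lambda>\<omega>. f (\<tau> x \<omega>)) \<longleftrightarrow> integrable M f"
  using integrable_distr_eq[of "\<tau> x" M M f] by (simp add: tau_preserving)

lemma AE_tau:
  assumes "AE \<omega> in M. P \<omega>"
  shows "AE \<omega> in M. P (\<tau> x \<omega>)"
proof (rule AE_distrD[of "\<tau> x" M M])
  show "AE \<omega> in distr M M (\<tau> x). P \<omega>" using assms by (subst tau_preserving)
qed simp

lemma tau_commute:
  "\<omega> \<in> space M \<Longrightarrow> \<tau> x (\<tau> y \<omega>) = \<tau> y (\<tau> x \<omega>)"
  by (metis add.commute tau_add)

lemma tau_space: "\<omega> \<in> space M \<Longrightarrow> \<tau> x \<omega> \<in> space M"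
  by (rule measurable_space[of "\<tau> x" M M]) simp_all

text \<open>The sum over \<open>P\<close> is measurable with respect to the sigma algebra generated by the field on \<open>P\<close>.
  The set \<open>P\<close> has to be nonempty because \<open>setdist {} {y} = 0\<close>.\<close>

lemma indep_var_separated:
  assumes B [measurable]: "B \<in> borel_measurable M"
    and frd: "finite_range_dependence M \<tau> B R"
    and P: "P \<noteq> {}" "\<And>z. z \<in> P \<Longrightarrow> R \<le> dist z y"
  shows "indep_var borel (\<lambda>\<omega>. \<Sum>z\<in>P. B (\<tau> z \<omega>) $ j) borel (\<lambda>\<omega>. B (\<tau> y \<omega>) $ j)"
proof -
  have *: "sigma_sets (space M) {X -` E \<inter> space M |E. E \<in> sets borel} \<subseteq> sigma_field_on M \<tau> B U"
    if U: "\<And>N. space N = space M \<Longrightarrow> (\<And>x. x \<in> U \<Longrightarrow> (\<lambda>\<omega>. B (\<tau> x \<omega>)) \<in> borel_measurable N)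
      \<Longrightarrow> X \<in> borel_measurable N" for U and X :: "'a \<Rightarrow> real"
  proof -
    let ?G = "{(\<lambda>\<omega>. B (\<tau> x \<omega>)) -` E \<inter> space M | x E. x \<in> U \<and> E \<in> sets borel}"
    define N where "N = sigma (space M) ?G"
    have G: "?G \<subseteq> Pow (space M)" by auto
    have sp: "space N = space M" and st: "sets N = sigma_field_on M \<tau> B U"
      using G by (simp_all add: N_def sigma_field_on_def sets_measure_of)
    have "(\<lambda>\<omega>. B (\<tau> x \<omega>)) \<in> borel_measurable N" if x: "x \<in> U" for x
    proof (rule measurableI)
      fix E :: "(real ^ 'n) set" assume "E \<in> sets borel"
      then show "(\<lambda>\<omega>. B (\<tau> x \<omega>)) -` E \<inter> space N \<in> sets N"
        unfolding sp st sigma_field_on_def using x by (intro sigma_sets.Basic) auto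
    qed simp
    then have X: "X \<in> borel_measurable N" using U sp by blast
    have "sigma_sets (space N) {X -` E \<inter> space M |E. E \<in> sets borel} \<subseteq> sets N"
      using measurable_sets[OF X] by (intro sets.sigma_sets_subset) (auto simp: sp)
    then show ?thesis by (simp add: sp st)
  qed
  have "setdist P {y} \<ge> R" using P by (auto intro: le_setdistI)
  then have "indep_set (sigma_field_on M \<tau> B P) (sigma_field_on M \<tau> B {y})"
    using frd unfolding finite_range_dependence_def by blast
  moreover have "sigma_sets (space M) {(\<lambda>\<omega>. \<Sum>z\<in>P. B (\<tau> z \<omega>) $ j) -` E \<inter> space M |E. E \<in> sets borel}
      \<subseteq> sigma_field_on M \<tau> B P"
    by (rule *) (auto intro!: borel_measurable_sum borel_measurable_vec_nth)
  moreover have "sigma_sets (space M) {(\<lambda>\<omega>. B (\<tau> y \<omega>) $ j) -` E \<inter> space M |E. E \<in> sets borel}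
      \<subseteq> sigma_field_on M \<tau> B {y}"
    by (rule *) (auto intro!: borel_measurable_vec_nth)
  ultimately show ?thesis
    unfolding indep_var_eq indep_sets2_eq
    by (intro conjI) (measurable, blast+)
qed

end

text \<open>The constant \<open>K\<close> in the moment bound \<open>E|X\<^sub>1 + ... + X\<^sub>N|^p \<le> (K N)^(p / 2) \<beta>\<close>.\<close>

definition moment_const :: "real \<Rightarrow> real"
  where "moment_const p = 3 * taylor_const p"

lemma moment_const_ge_1: "p \<ge> 2 \<Longrightarrow> moment_const p \<ge> 1"
proof -
  assume p: "p \<ge> 2"
  have "1 \<le> 2 powr p" using p by (simp add: ge_one_powr_ge_zero)
  moreover have "1 \<le> p\<^sup>2" using p by simp
  ultimately have "1 * 1 \<le> 2 powr p * p\<^sup>2" by (intro mult_mono) auto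
  then show ?thesis by (simp add: moment_const_def taylor_const_def)
qed

text \<open>The induction step of the moment bound, from \<open>m\<close> to \<open>m + 1\<close> summands. The quadratic term
  \<open>|X|^(p - 2) Y\<^sup>2\<close> is split at the scale \<open>l^(1/2)\<close>, \<open>l = K m\<close>, which is the size of \<open>X\<close>; its mean is at most
  \<open>2 l^(p / 2 - 1) \<beta>\<close>, and \<open>K = 3 C\<close> is just enough to absorb this and the term \<open>C |Y|^p\<close> into
  the increment of \<open>(K m)^(p / 2)\<close>.\<close>

lemma (in prob_space) moment_indep_add:
  fixes X Y :: "'a \<Rightarrow> real" and m \<beta> p :: real
  assumes p: "p \<ge> 2" and ind: "indep_var borel X borel Y"
    and X: "integrable M (\<lambda>\<omega>. \<bar>X \<omega>\<bar> powr p)" and Y: "integrable M (\<lambda>\<omega>. \<bar>Y \<omega>\<bar> powr p)"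
    and Y0: "expectation Y = 0" and m: "m \<ge> 1"
    and Xle: "expectation (\<lambda>\<omega>. \<bar>X \<omega>\<bar> powr p) \<le> (moment_const p * m) powr (p / 2) * \<beta>"
    and Yle: "expectation (\<lambda>\<omega>. \<bar>Y \<omega>\<bar> powr p) \<le> \<beta>"
  shows "expectation (\<lambda>\<omega>. \<bar>X \<omega> + Y \<omega>\<bar> powr p) \<le> (moment_const p * (m + 1)) powr (p / 2) * \<beta>"
proof -
  have [measurable]: "X \<in> borel_measurable M" "Y \<in> borel_measurable M"
    using indep_var_rv1[OF ind] indep_var_rv2[OF ind] by auto
  define K C l where "K = moment_const p" and "C = taylor_const p" and "l = K * m"
  have K: "K \<ge> 1" "K = 3 * C" using moment_const_ge_1[OF p] by (simp_all add: K_def C_def moment_const_def)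
  have "1 * 1 \<le> K * m" using K m by (intro mult_mono) auto
  then have l: "l \<ge> 1" by (simp add: l_def)
  have \<beta>: "\<beta> \<ge> 0" using Yle order_trans[OF Bochner_Integration.integral_nonneg, of M "\<lambda>\<omega>. \<bar>Y \<omega>\<bar> powr p" \<beta>] by auto
  let ?\<phi> = "\<lambda>x::real. sgn x * \<bar>x\<bar> powr (p - 1)"
  have \<phi>int: "integrable M (\<lambda>\<omega>. ?\<phi> (X \<omega>))"
    by (rule Bochner_Integration.integrable_bound[OF integrable_powr_lower[OF prob_space_axioms _ X, of "p - 1"]])
       (use p in \<open>auto simp: abs_mult sgn_if\<close>)
  have Yint: "integrable M Y" using integrable_of_powr[OF prob_space_axioms _ Y] p by auto
  have [measurable]: "?\<phi> \<in> borel_measurable borel" by measurable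
  have \<phi>ind: "indep_var borel (\<lambda>\<omega>. ?\<phi> (X \<omega>)) borel Y"
    using indep_var_compose[OF ind \<open>?\<phi> \<in> borel_measurable borel\<close> measurable_ident_sets[OF refl]]
    by (simp add: o_def)
  have lin: "integrable M (\<lambda>\<omega>. ?\<phi> (X \<omega>) * Y \<omega>)" "expectation (\<lambda>\<omega>. ?\<phi> (X \<omega>) * Y \<omega>) = 0"
    using indep_var_integrable[OF \<phi>ind \<phi>int Yint] indep_var_lebesgue_integral[OF \<phi>ind \<phi>int Yint] Y0 by auto
  have quad: "\<bar>x\<bar> powr (p - 2) * y\<^sup>2 \<le> l powr (p / 2 - 1) * (\<bar>x\<bar> powr p / l powr (p / 2) + \<bar>y\<bar> powr p)" for x y :: real
  proof -
    define u where "u = \<bar>x\<bar> / l powr (1/2)"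
    have u: "u \<ge> 0" by (simp add: u_def)
    have "\<bar>x\<bar> = l powr (1/2) * u" using l by (simp add: u_def)
    then have "\<bar>x\<bar> powr (p - 2) * y\<^sup>2 = (l powr (1/2) * u) powr (p - 2) * y\<^sup>2" by simp
    also have "\<dots> = l powr (p / 2 - 1) * (\<bar>u\<bar> powr (p - 2) * y\<^sup>2)"
      using u by (simp add: powr_mult powr_powr diff_divide_distrib mult.assoc)
    also have "\<dots> \<le> l powr (p / 2 - 1) * (\<bar>u\<bar> powr p + \<bar>y\<bar> powr p)"
      using p by (intro mult_left_mono powr_mult_square_le) auto
    also have "\<bar>u\<bar> powr p = \<bar>x\<bar> powr p / l powr (p / 2)"
      by (simp add: u_def powr_divide powr_powr)
    finally show ?thesis .
  qed
  have pt: "\<bar>X \<omega> + Y \<omega>\<bar> powr p \<le> \<bar>X \<omega>\<bar> powr p + p * (?\<phi> (X \<omega>) * Y \<omega>)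
      + C * (l powr (p / 2 - 1) * (\<bar>X \<omega>\<bar> powr p / l powr (p / 2) + \<bar>Y \<omega>\<bar> powr p) + \<bar>Y \<omega>\<bar> powr p)" for \<omega>
  proof -
    have "C * (\<bar>X \<omega>\<bar> powr (p - 2) * (Y \<omega>)\<^sup>2 + \<bar>Y \<omega>\<bar> powr p)
        \<le> C * (l powr (p / 2 - 1) * (\<bar>X \<omega>\<bar> powr p / l powr (p / 2) + \<bar>Y \<omega>\<bar> powr p) + \<bar>Y \<omega>\<bar> powr p)"
      using K by (intro mult_left_mono add_right_mono quad) auto
    then show ?thesis
      using powr_add_le_taylor[OF p, of "X \<omega>" "Y \<omega>"] unfolding C_def mult.assoc by linarith
  qed
  have "expectation (\<lambda>\<omega>. \<bar>X \<omega> + Y \<omega>\<bar> powr p) \<le> expectation (\<lambda>\<omega>. \<bar>X \<omega>\<bar> powr p + p * (?\<phi> (X \<omega>) * Y \<omega>)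
      + C * (l powr (p / 2 - 1) * (\<bar>X \<omega>\<bar> powr p / l powr (p / 2) + \<bar>Y \<omega>\<bar> powr p) + \<bar>Y \<omega>\<bar> powr p))"
    by (rule integral_mono[OF _ _ pt])
       (use p X Y lin in \<open>auto intro!: integrable_powr_add Bochner_Integration.integrable_add integrable_mult_right\<close>)
  also have "\<dots> = expectation (\<lambda>\<omega>. \<bar>X \<omega>\<bar> powr p)
      + C * (l powr (p / 2 - 1) * (expectation (\<lambda>\<omega>. \<bar>X \<omega>\<bar> powr p) / l powr (p / 2)
         + expectation (\<lambda>\<omega>. \<bar>Y \<omega>\<bar> powr p)) + expectation (\<lambda>\<omega>. \<bar>Y \<omega>\<bar> powr p))"
    using X Y lin by simp
  also have "\<dots> \<le> l powr (p / 2) * \<beta> + C * (l powr (p / 2 - 1) * (l powr (p / 2) * \<beta> / l powr (p / 2) + \<beta>) + \<beta>)"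
    using Xle Yle K by (intro add_mono mult_left_mono divide_right_mono) (auto simp: l_def K_def)
  also have "\<dots> = l powr (p / 2) * \<beta> + C * (l powr (p / 2 - 1) * (2 * \<beta>) + 1 * \<beta>)"
    using l by simp
  also have "\<dots> \<le> l powr (p / 2) * \<beta> + C * (l powr (p / 2 - 1) * (2 * \<beta>) + l powr (p / 2 - 1) * \<beta>)"
    using l p \<beta> K by (intro add_mono mult_left_mono mult_right_mono order_refl ge_one_powr_ge_zero) auto
  also have "l powr (p / 2) = l * l powr (p / 2 - 1)"
    using l by (simp add: powr_mult_base)
  also have "l * l powr (p / 2 - 1) * \<beta> + C * (l powr (p / 2 - 1) * (2 * \<beta>) + l powr (p / 2 - 1) * \<beta>)
      = (K * (m + 1)) * l powr (p / 2 - 1) * \<beta>"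
    by (simp add: l_def K algebra_simps)
  also have "\<dots> \<le> (K * (m + 1)) * (K * (m + 1)) powr (p / 2 - 1) * \<beta>"
    using K m p \<beta> by (intro mult_right_mono mult_left_mono powr_mono2) (auto simp: l_def)
  also have "(K * (m + 1)) * (K * (m + 1)) powr (p / 2 - 1) = (K * (m + 1)) powr (p / 2)"
    using K m by (subst powr_mult_base) auto
  finally show ?thesis by (simp add: K_def)
qed

context random_environment
begin

text \<open>The \<open>p\<close>-th moment of a sum over separated points grows like that of a random walk.\<close>

lemma moment_sum_separated:
  assumes B [measurable]: "B \<in> borel_measurable M"
    and frd: "finite_range_dependence M \<tau> B R" and p: "p \<ge> 2"
    and int: "integrable M (\<lambda>\<omega>. \<bar>B \<omega> $ j\<bar> powr p)" and mean: "(LINT \<omega>|M. B \<omega> $ j) = 0"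
    and P: "finite P" "\<And>y z. y \<in> P \<Longrightarrow> z \<in> P \<Longrightarrow> y \<noteq> z \<Longrightarrow> R \<le> dist y z"
  shows "integrable M (\<lambda>\<omega>. \<bar>\<Sum>z\<in>P. B (\<tau> z \<omega>) $ j\<bar> powr p)" (is ?int)
    and "(LINT \<omega>|M. \<bar>\<Sum>z\<in>P. B (\<tau> z \<omega>) $ j\<bar> powr p)
       \<le> (moment_const p * card P) powr (p / 2) * (LINT \<omega>|M. \<bar>B \<omega> $ j\<bar> powr p)" (is ?le)
proof -
  define \<beta> where "\<beta> = (LINT \<omega>|M. \<bar>B \<omega> $ j\<bar> powr p)"
  have "?int \<and> ?le" using P
  proof (induction P rule: finite_induct)
    case empty
    then show ?case using p by simp
  next
    case (insert y P)
    have IH: "integrable M (\<lambda>\<omega>. \<bar>\<Sum>z\<in>P. B (\<tau> z \<omega>) $ j\<bar> powr p)"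
        "(LINT \<omega>|M. \<bar>\<Sum>z\<in>P. B (\<tau> z \<omega>) $ j\<bar> powr p) \<le> (moment_const p * card P) powr (p / 2) * \<beta>"
      using insert by (auto simp: \<beta>_def)
    have Y: "integrable M (\<lambda>\<omega>. \<bar>B (\<tau> y \<omega>) $ j\<bar> powr p)"
      using int integrable_tau[of "\<lambda>\<omega>. \<bar>B \<omega> $ j\<bar> powr p" y] by simp
    have Y0: "(LINT \<omega>|M. B (\<tau> y \<omega>) $ j) = 0"
      using mean integral_tau[of "\<lambda>\<omega>. B \<omega> $ j" y] by simp
    have Yb: "(LINT \<omega>|M. \<bar>B (\<tau> y \<omega>) $ j\<bar> powr p) = \<beta>"
      using integral_tau[of "\<lambda>\<omega>. \<bar>B \<omega> $ j\<bar> powr p" y] by (simp add: \<beta>_def)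
    have eq: "(\<Sum>z\<in>insert y P. B (\<tau> z \<omega>) $ j) = (\<Sum>z\<in>P. B (\<tau> z \<omega>) $ j) + B (\<tau> y \<omega>) $ j" for \<omega>
      using insert by simp
    have int': "integrable M (\<lambda>\<omega>. \<bar>(\<Sum>z\<in>P. B (\<tau> z \<omega>) $ j) + B (\<tau> y \<omega>) $ j\<bar> powr p)"
      using p by (intro integrable_powr_add IH Y) auto
    have \<beta>0: "\<beta> \<ge> 0" by (simp add: \<beta>_def)
    have "(LINT \<omega>|M. \<bar>(\<Sum>z\<in>P. B (\<tau> z \<omega>) $ j) + B (\<tau> y \<omega>) $ j\<bar> powr p)
        \<le> (moment_const p * (real (card P) + 1)) powr (p / 2) * \<beta>"
    proof (cases "P = {}")
      case True
      have "1 \<le> moment_const p powr (p / 2)"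
        using moment_const_ge_1[OF p] p by (intro ge_one_powr_ge_zero) auto
      then have "1 * \<beta> \<le> moment_const p powr (p / 2) * \<beta>" using \<beta>0 by (intro mult_right_mono)
      then show ?thesis using True Yb by simp
    next
      case False
      have ind: "indep_var borel (\<lambda>\<omega>. \<Sum>z\<in>P. B (\<tau> z \<omega>) $ j) borel (\<lambda>\<omega>. B (\<tau> y \<omega>) $ j)"
        using insert by (intro indep_var_separated[OF B frd False]) auto
      have "1 \<le> card P" using False insert(1) by (simp add: Suc_le_eq card_gt_0_iff)
      then show ?thesis
        using IH Y Y0 Yb by (intro moment_indep_add[OF p ind]) auto
    qed
    then show ?case
      unfolding eq using int' insert by (simp add: \<beta>_def add.commute)
  qed
  then show ?int ?le by auto
qed

end

section \<open>Square-integrable functions\<close>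

lemma integrable_square_diff:
  fixes f g :: "'a \<Rightarrow> real"
  assumes [measurable]: "f \<in> borel_measurable M" "g \<in> borel_measurable M"
    and int: "integrable M (\<lambda>x. (f x)\<^sup>2)" "integrable M (\<lambda>x. (g x)\<^sup>2)"
  shows "integrable M (\<lambda>x. (f x - g x)\<^sup>2)"
proof -
  have "integrable M (\<lambda>x. (f x)\<^sup>2 + (g x)\<^sup>2 - 2 * (f x * g x))"
    using int integrable_mult_of_squares[OF assms] by auto
  then show ?thesis by (simp add: power2_diff algebra_simps)
qed

text \<open>A weak form of the Cauchy-Schwarz inequality: it suffices for passing to limits in the second
  factor.\<close>

lemma abs_integral_mult_le:
  fixes f g :: "'a \<Rightarrow> real"
  assumes [measurable]: "f \<in> borel_measurable M" "g \<in> borel_measurable M"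
    and int: "integrable M (\<lambda>x. (f x)\<^sup>2)" "integrable M (\<lambda>x. (g x)\<^sup>2)"
  shows "\<bar>LINT x|M. f x * g x\<bar> \<le> ((LINT x|M. (f x)\<^sup>2) + 1) * sqrt (LINT x|M. (g x)\<^sup>2)"
proof (cases "(LINT x|M. (g x)\<^sup>2) = 0")
  case True
  then have "AE x in M. (g x)\<^sup>2 = 0"
    using int(2) by (subst (asm) integral_nonneg_eq_0_iff_AE) auto
  then have "(LINT x|M. f x * g x) = (LINT x|M. 0)" by (intro integral_cong_AE) auto
  then show ?thesis using True by simp
next
  case False
  define r where "r = sqrt (LINT x|M. (g x)\<^sup>2)"
  have g0: "(LINT x|M. (g x)\<^sup>2) \<ge> 0" by simp
  then have "(LINT x|M. (g x)\<^sup>2) > 0" using False by linarith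
  then have r: "r > 0" "r\<^sup>2 = (LINT x|M. (g x)\<^sup>2)" by (simp_all add: r_def)
  have pt: "\<bar>a * b\<bar> \<le> r * a\<^sup>2 + b\<^sup>2 / r" for a b :: real
  proof -
    have "2 * \<bar>(r * a) * b\<bar> \<le> (r * a)\<^sup>2 + b\<^sup>2"
      using sum_squares_bound[of "\<bar>r * a\<bar>" "\<bar>b\<bar>"] by (simp add: abs_mult power_mult_distrib)
    then have "\<bar>(r * a) * b\<bar> \<le> (r * a)\<^sup>2 + b\<^sup>2" by linarith
    then have "r * \<bar>a * b\<bar> \<le> r * (r * a\<^sup>2 + b\<^sup>2 / r)"
      using r(1) by (simp add: abs_mult power2_eq_square algebra_simps)
    then show ?thesis using r(1) by (rule mult_left_le_imp_le)
  qed
  have "\<bar>LINT x|M. f x * g x\<bar> \<le> (LINT x|M. \<bar>f x * g x\<bar>)" by (rule integral_abs_bound)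
  also have "\<dots> \<le> (LINT x|M. r * (f x)\<^sup>2 + (g x)\<^sup>2 / r)"
    using int integrable_mult_of_squares[OF assms] by (intro integral_mono pt) auto
  also have "\<dots> = r * (LINT x|M. (f x)\<^sup>2) + r\<^sup>2 / r" using int r by simp
  also have "\<dots> = ((LINT x|M. (f x)\<^sup>2) + 1) * r" using r(1) by (simp add: power2_eq_square algebra_simps)
  finally show ?thesis by (simp add: r_def)
qed

section \<open>Horizontal derivatives of test functions\<close>

lemma Lp_2_iff:
  fixes f :: "'a \<Rightarrow> real"
  shows "f \<in> Lp M 2 \<longleftrightarrow> f \<in> borel_measurable M \<and> integrable M (\<lambda>\<omega>. (f \<omega>)\<^sup>2)"
  by (simp add: Lp_def powr_numeral)

text \<open>The facts on a test kernel that are used: it has continuous partial derivatives, and it vanishes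
  together with them outside a ball.\<close>

lemma Cc_infinityD:
  assumes "\<eta> \<in> Cc_infinity"
  obtains r where "r > 0"
    "continuous_on UNIV \<eta>"
    "\<And>x. (\<eta> has_derivative frechet_derivative \<eta> (at x)) (at x)"
    "\<And>i. continuous_on UNIV (\<lambda>x. frechet_derivative \<eta> (at x) (axis i 1))"
    "\<And>x. x \<notin> cball 0 r \<Longrightarrow> \<eta> x = 0"
    "\<And>x i. x \<notin> cball 0 r \<Longrightarrow> frechet_derivative \<eta> (at x) (axis i 1) = 0"
proof -
  have Ck: "Ck k \<eta>" for k using assms by (auto simp: Cc_infinity_def)
  have c: "compact (closure {x. \<eta> x \<noteq> 0})" using assms by (auto simp: Cc_infinity_def)
  have "bounded {x. \<eta> x \<noteq> 0}"
    using bounded_subset[OF compact_imp_bounded[OF c] closure_subset] .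
  then obtain r0 where r0: "\<And>x. \<eta> x \<noteq> 0 \<Longrightarrow> norm x \<le> r0"
    unfolding bounded_iff by blast
  define r where "r = max r0 1"
  have r: "\<eta> x = 0" if "x \<notin> cball 0 r" for x
    using r0[of x] that unfolding r_def mem_cball_0 by linarith
  have "\<eta> differentiable_on UNIV" using Ck[of "Suc 0"] by simp
  then have d: "(\<eta> has_derivative frechet_derivative \<eta> (at x)) (at x)" for x
    by (simp add: differentiable_on_def frechet_derivative_works)
  have z: "frechet_derivative \<eta> (at x) (axis i 1) = 0" if x: "x \<notin> cball 0 r" for x i
  proof -
    have "(\<eta> has_derivative (\<lambda>_. 0)) (at x)"
    proof (rule has_derivative_transform_within_open[of "\<lambda>_. 0" _ _ _ "- cball 0 r"])
      show "open (- cball (0 :: real ^ 'n) r)" by (intro open_Compl closed_cball)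
    qed (use x r in auto)
    then have "frechet_derivative \<eta> (at x) = (\<lambda>_. 0)"
      using d has_derivative_unique by blast
    then show ?thesis by simp
  qed
  show ?thesis
    by (rule that[of r]) (use Ck[of 0] Ck[of "Suc 0"] d r z in \<open>auto simp: r_def\<close>)
qed

text \<open>Uniform convergence of the difference quotients, by the mean value theorem and the uniform
  continuity of the partial derivative on a large ball.\<close>

lemma difference_quotient_uniform:
  fixes \<eta> :: "real ^ 'n::finite \<Rightarrow> real" and i :: 'n
  assumes "\<eta> \<in> Cc_infinity"
  defines "g \<equiv> (\<lambda>x. frechet_derivative \<eta> (at x) (axis i 1))"
  shows "\<exists>r>0. \<forall>e>0. \<exists>d>0. \<forall>h x. 0 < \<bar>h\<bar> \<and> \<bar>h\<bar> < d \<longrightarrow>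
       \<bar>(\<eta> (x - h *\<^sub>R axis i 1) - \<eta> x) / h + g x\<bar> \<le> e * indicator (cball 0 r) x"
proof -
  obtain r where r: "r > 0"
    and d: "\<And>x. (\<eta> has_derivative frechet_derivative \<eta> (at x)) (at x)"
    and gc: "continuous_on UNIV g"
    and z: "\<And>x. x \<notin> cball 0 r \<Longrightarrow> \<eta> x = 0" "\<And>x. x \<notin> cball 0 r \<Longrightarrow> g x = 0"
    using Cc_infinityD[OF assms(1)] unfolding g_def by metis
  have ax: "norm (axis i (1::real)) = 1" by simp
  have line: "((\<lambda>s. \<eta> (x - s *\<^sub>R axis i 1)) has_real_derivative - g (x - s *\<^sub>R axis i 1)) (at s)" for x s
  proof -
    have 1: "((\<lambda>s. x - s *\<^sub>R axis i 1) has_derivative (\<lambda>t. - (t *\<^sub>R axis i 1))) (at s)"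
      by (auto intro!: derivative_eq_intros)
    have lin: "linear (frechet_derivative \<eta> (at y))" for y
      using d has_derivative_linear by blast
    have "((\<lambda>s. \<eta> (x - s *\<^sub>R axis i 1)) has_derivative
        (\<lambda>t. frechet_derivative \<eta> (at (x - s *\<^sub>R axis i 1)) (- (t *\<^sub>R axis i 1)))) (at s)"
      using diff_chain_at[OF 1 d] by (simp add: o_def)
    moreover have "frechet_derivative \<eta> (at y) (- (t *\<^sub>R axis i 1)) = - g y * t" for y t
      using linear_cmul[OF lin, of y "-t" "axis i 1"] by (simp add: g_def)
    moreover have "(*) (- g y) = (\<lambda>t. - g y * t)" for y by auto
    ultimately show ?thesis unfolding has_field_derivative_def by simp
  qed
  show ?thesis
  proof (rule exI[of _ "r + 1"], intro conjI allI impI)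
    show "r + 1 > 0" using r by simp
    fix e :: real assume e: "e > 0"
    have "uniformly_continuous_on (cball 0 (r + 2)) g"
      using gc by (intro compact_uniformly_continuous) (auto intro: continuous_on_subset)
    then obtain \<delta> where \<delta>: "\<delta> > 0"
      "\<And>x y. x \<in> cball 0 (r + 2) \<Longrightarrow> y \<in> cball 0 (r + 2) \<Longrightarrow> dist y x < \<delta> \<Longrightarrow> dist (g y) (g x) < e"
      unfolding uniformly_continuous_on_def using e by metis
    show "\<exists>d>0. \<forall>h x. 0 < \<bar>h\<bar> \<and> \<bar>h\<bar> < d \<longrightarrow>
       \<bar>(\<eta> (x - h *\<^sub>R axis i 1) - \<eta> x) / h + g x\<bar> \<le> e * indicator (cball 0 (r + 1)) x"
    proof (intro exI[of _ "min \<delta> 1"] conjI allI impI)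
      fix h :: real and x :: "real ^ 'n"
      assume "0 < \<bar>h\<bar> \<and> \<bar>h\<bar> < min \<delta> 1"
      then have h: "h \<noteq> 0" "\<bar>h\<bar> < \<delta>" "\<bar>h\<bar> < 1" by auto
      have nrm: "norm (s *\<^sub>R axis i (1::real)) = \<bar>s\<bar>" for s using ax by simp
      have "\<exists>s. \<bar>s\<bar> \<le> \<bar>h\<bar> \<and> \<eta> (x - h *\<^sub>R axis i 1) - \<eta> x = h * (- g (x - s *\<^sub>R axis i 1))"
      proof (cases "h > 0")
        case True
        then show ?thesis using MVT2[OF True line[of x]] by force
      next
        case False
        then have "h < 0" using h by auto
        from MVT2[OF this line[of x]] obtain s where "h < s" "s < 0"
          "\<eta> (x - 0 *\<^sub>R axis i 1) - \<eta> (x - h *\<^sub>R axis i 1) = (0 - h) * (- g (x - s *\<^sub>R axis i 1))"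
          by blast
        then show ?thesis by (intro exI[of _ s]) (auto simp: algebra_simps)
      qed
      then obtain s where s: "\<bar>s\<bar> \<le> \<bar>h\<bar>"
        "\<eta> (x - h *\<^sub>R axis i 1) - \<eta> x = h * (- g (x - s *\<^sub>R axis i 1))" by blast
      then have eq: "(\<eta> (x - h *\<^sub>R axis i 1) - \<eta> x) / h + g x = g x - g (x - s *\<^sub>R axis i 1)"
        using h by simp
      have tri: "norm x - \<bar>s\<bar> \<le> norm (x - s *\<^sub>R axis i 1)" "norm (x - s *\<^sub>R axis i 1) \<le> norm x + \<bar>s\<bar>"
        using norm_triangle_ineq2[of x "s *\<^sub>R axis i 1"] norm_triangle_ineq4[of x "s *\<^sub>R axis i 1"] nrm by auto
      show "\<bar>(\<eta> (x - h *\<^sub>R axis i 1) - \<eta> x) / h + g x\<bar> \<le> e * indicator (cball 0 (r + 1)) x"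
      proof (cases "x \<in> cball 0 (r + 1)")
        case True
        have "x \<in> cball 0 (r + 2)" "x - s *\<^sub>R axis i 1 \<in> cball 0 (r + 2)"
          unfolding mem_cball_0 using True s h tri by (auto simp: mem_cball_0)
        moreover have "dist x (x - s *\<^sub>R axis i 1) < \<delta>"
          using s h nrm by (simp add: dist_norm)
        ultimately have "dist (g x) (g (x - s *\<^sub>R axis i 1)) < e" by (intro \<delta>(2))
        then show ?thesis unfolding eq using True by (simp add: dist_real_def)
      next
        case False
        then have "x \<notin> cball 0 r" "x - s *\<^sub>R axis i 1 \<notin> cball 0 r"
          using s h tri by (auto simp: mem_cball_0)
        then show ?thesis unfolding eq using z False by simp
      qed
    qed (use \<delta> in auto)
  qed
qed

lemma integrable_continuous_compact_support:
  fixes k :: "real ^ 'n::finite \<Rightarrow> real"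
  assumes "continuous_on UNIV k" "\<And>x. x \<notin> cball 0 r \<Longrightarrow> k x = 0"
  shows "integrable lborel k"
proof -
  have "set_integrable lborel (cball 0 r) k"
    unfolding set_integrable_def
    by (rule borel_integrable_compact) (use assms(1) in \<open>auto intro: continuous_on_subset\<close>)
  moreover have "(\<lambda>x. indicator (cball 0 r) x *\<^sub>R k x) = k"
    using assms(2) by (auto simp: indicator_def fun_eq_iff)
  ultimately show ?thesis by (simp add: set_integrable_def)
qed

context random_environment
begin

text \<open>By Fubini's theorem, an essential bound passes to almost every point of almost every orbit.\<close>

lemma Linfty_orbit_bound:
  fixes f :: "'a \<Rightarrow> real"
  assumes "f \<in> Linfty M"
  obtains C where "C \<ge> 0" "AE \<omega> in M. AE x in lborel. \<bar>f (\<tau> x \<omega>)\<bar> \<le> C"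
proof -
  have [measurable]: "f \<in> borel_measurable M" using assms by (simp add: Linfty_def)
  obtain C where C: "AE \<omega> in M. \<bar>f \<omega>\<bar> \<le> C" using assms by (auto simp: Linfty_def)
  have "AE x in (lborel :: (real ^ 'n) measure). AE \<omega> in M. \<bar>f (\<tau> x \<omega>)\<bar> \<le> max C 0"
  proof (rule AE_I2)
    show "AE \<omega> in M. \<bar>f (\<tau> x \<omega>)\<bar> \<le> max C 0" for x
      using AE_tau[OF C, of x] by eventually_elim auto
  qed
  moreover have "pair_sigma_finite (lborel :: (real ^ 'n) measure) M"
    by (intro pair_sigma_finite.intro lborel.sigma_finite_measure_axioms sigma_finite_measure_axioms)
  moreover have "{z \<in> space ((lborel :: (real ^ 'n) measure) \<Otimes>\<^sub>M M). \<bar>f (\<tau> (fst z) (snd z))\<bar> \<le> max C 0}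
      \<in> sets (lborel \<Otimes>\<^sub>M M)"
    by measurable
  ultimately have "AE \<omega> in M. AE x in (lborel :: (real ^ 'n) measure). \<bar>f (\<tau> x \<omega>)\<bar> \<le> max C 0"
    by (subst pair_sigma_finite.AE_commute[symmetric]) assumption+
  then show ?thesis by (intro that[of "max C 0"]) auto
qed

lemma borel_measurable_smear [measurable]:
  fixes f :: "'a \<Rightarrow> real"
  assumes [measurable]: "f \<in> borel_measurable M" "k \<in> borel_measurable borel"
  shows "(\<lambda>\<omega>. LINT x|lborel. f (\<tau> x \<omega>) * k x) \<in> borel_measurable M"
  by (rule lborel.borel_measurable_lebesgue_integral) measurable

lemma integrable_smear:
  fixes u k :: "real ^ 'n \<Rightarrow> real"
  assumes [measurable]: "u \<in> borel_measurable borel" and k: "integrable lborel k"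
    and C: "AE x in lborel. \<bar>u x\<bar> \<le> C"
  shows "integrable lborel (\<lambda>x. u x * k x)"
    and "\<bar>LINT x|lborel. u x * k x\<bar> \<le> C * (LINT x|lborel. \<bar>k x\<bar>)"
proof -
  have [measurable]: "k \<in> borel_measurable borel" using borel_measurable_integrable[OF k] by simp
  have b: "AE x in lborel. \<bar>u x * k x\<bar> \<le> C * \<bar>k x\<bar>"
    using C by eventually_elim (auto simp: abs_mult intro: mult_right_mono)
  show i: "integrable lborel (\<lambda>x. u x * k x)"
    by (rule Bochner_Integration.integrable_bound[of _ "\<lambda>x. C * \<bar>k x\<bar>"])
       (use k b in auto)
  have "\<bar>LINT x|lborel. u x * k x\<bar> \<le> (LINT x|lborel. \<bar>u x * k x\<bar>)" by (rule integral_abs_bound)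
  also have "\<dots> \<le> (LINT x|lborel. C * \<bar>k x\<bar>)"
    using i k b by (intro integral_mono_AE) auto
  finally show "\<bar>LINT x|lborel. u x * k x\<bar> \<le> C * (LINT x|lborel. \<bar>k x\<bar>)" by simp
qed

lemma smear_Lp_2:
  fixes f :: "'a \<Rightarrow> real"
  assumes f: "f \<in> Linfty M" and k: "integrable lborel k"
  shows "(\<lambda>\<omega>. LINT x|lborel. f (\<tau> x \<omega>) * k x) \<in> Lp M 2"
proof -
  have [measurable]: "f \<in> borel_measurable M" using f by (simp add: Linfty_def)
  have [measurable]: "k \<in> borel_measurable borel" using borel_measurable_integrable[OF k] by simp
  obtain C where C: "C \<ge> 0" "AE \<omega> in M. AE x in lborel. \<bar>f (\<tau> x \<omega>)\<bar> \<le> C"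
    using Linfty_orbit_bound[OF f] .
  have "AE \<omega> in M. \<bar>LINT x|lborel. f (\<tau> x \<omega>) * k x\<bar> \<le> C * (LINT x|lborel. \<bar>k x\<bar>)"
    using C(2) AE_space
  proof eventually_elim
    case (elim \<omega>)
    then show ?case by (intro integrable_smear k) auto
  qed
  then have "AE \<omega> in M. (LINT x|lborel. f (\<tau> x \<omega>) * k x)\<^sup>2 \<le> (C * (LINT x|lborel. \<bar>k x\<bar>))\<^sup>2"
    by eventually_elim (metis abs_ge_zero power2_abs power_mono)
  then have "integrable M (\<lambda>\<omega>. (LINT x|lborel. f (\<tau> x \<omega>) * k x)\<^sup>2)"
    by (intro integrable_const_bound[of _ "(C * (LINT x|lborel. \<bar>k x\<bar>))\<^sup>2"]) auto
  then show ?thesis by (simp add: Lp_2_iff)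
qed

text \<open>Translating the environment by \<open>h e\<^sub>i\<close> amounts to translating the kernel by \<open>h e\<^sub>i\<close>, so the
  difference quotients converge even uniformly, up to null sets, with limit the smear against
  \<open>- \<partial>\<^sub>i \<eta>\<close>.\<close>

lemma smear_has_horizontal_derivative:
  fixes f :: "'a \<Rightarrow> real"
  assumes f: "f \<in> Linfty M" and \<eta>: "\<eta> \<in> Cc_infinity"
  shows "has_horizontal_derivative M \<tau> i (\<lambda>\<omega>. LINT x|lborel. f (\<tau> x \<omega>) * \<eta> x)
    (\<lambda>\<omega>. LINT x|lborel. f (\<tau> x \<omega>) * - frechet_derivative \<eta> (at x) (axis i 1))"
proof -
  define g where "g = (\<lambda>x. frechet_derivative \<eta> (at x) (axis i 1))"
  define \<psi> where "\<psi> = (\<lambda>\<omega>. LINT x|lborel. f (\<tau> x \<omega>) * \<eta> x)"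
  define D where "D = (\<lambda>\<omega>. LINT x|lborel. f (\<tau> x \<omega>) * - g x)"
  have fm [measurable]: "f \<in> borel_measurable M" using f by (simp add: Linfty_def)
  obtain r where r: "r > 0" "continuous_on UNIV \<eta>" "continuous_on UNIV g"
    "\<And>x. x \<notin> cball 0 r \<Longrightarrow> \<eta> x = 0" "\<And>x. x \<notin> cball 0 r \<Longrightarrow> g x = 0"
    using Cc_infinityD[OF \<eta>] unfolding g_def by metis
  have int\<eta>: "integrable lborel \<eta>" and intg: "integrable lborel (\<lambda>x. - g x)"
    using integrable_continuous_compact_support r by (blast, auto)
  have [measurable]: "\<eta> \<in> borel_measurable borel" "g \<in> borel_measurable borel"
    using r by (auto intro: borel_measurable_continuous_onI)
  obtain C where C: "C \<ge> 0" "AE \<omega> in M. AE x in lborel. \<bar>f (\<tau> x \<omega>)\<bar> \<le> C"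
    using Linfty_orbit_bound[OF f] .
  obtain r' where r': "r' > 0"
    "\<And>e. e > 0 \<Longrightarrow> \<exists>d>0. \<forall>h x. 0 < \<bar>h\<bar> \<and> \<bar>h\<bar> < d \<longrightarrow>
       \<bar>(\<eta> (x - h *\<^sub>R axis i 1) - \<eta> x) / h + g x\<bar> \<le> e * indicator (cball 0 r') x"
    using difference_quotient_uniform[OF \<eta>, of i] unfolding g_def by blast
  define V where "V = measure lborel (cball (0 :: real ^ 'n) r')"
  have intind: "integrable lborel (\<lambda>x. e * indicator (cball (0 :: real ^ 'n) r') x :: real)" for e
    by (intro integrable_mult_right integrable_real_indicator) (use emeasure_lborel_cball_finite in \<open>auto simp flip: infinity_ennreal_def\<close>)
  have quot: "\<bar>(\<psi> (\<tau> (h *\<^sub>R axis i 1) \<omega>) - \<psi> \<omega>) / h - D \<omega>\<bar> \<le> C * (e * V)"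
    if \<omega>: "\<omega> \<in> space M" "AE x in lborel. \<bar>f (\<tau> x \<omega>)\<bar> \<le> C" and h: "h \<noteq> 0"
      and e: "\<And>x. \<bar>(\<eta> (x - h *\<^sub>R axis i 1) - \<eta> x) / h + g x\<bar> \<le> e * indicator (cball 0 r') x"
    for \<omega> h e
  proof -
    let ?v = "h *\<^sub>R axis i 1 :: real ^ 'n"
    define u where "u = (\<lambda>x. f (\<tau> x \<omega>))"
    have [measurable]: "u \<in> borel_measurable borel" unfolding u_def using \<omega>(1) by measurable
    have u: "AE x in lborel. \<bar>u x\<bar> \<le> C" using \<omega>(2) by (simp add: u_def)
    have shift: "integrable lborel (\<lambda>x. \<eta> (x - ?v))"
      using int\<eta> integrable_distr_eq[of "(+) (- ?v)" lborel borel \<eta>] by (simp add: lborel_distr_plus)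
    have "\<psi> (\<tau> ?v \<omega>) = (LINT x|lborel. u (x + ?v) * \<eta> x)"
      unfolding \<psi>_def u_def using \<omega>(1) by (simp add: tau_add)
    also have "\<dots> = (LINT x|distr lborel borel ((+) ?v). u x * \<eta> (x - ?v))"
      by (subst integral_distr) (auto simp: add.commute)
    also have "\<dots> = (LINT x|lborel. u x * \<eta> (x - ?v))"
      by (simp add: lborel_distr_plus)
    finally have 1: "\<psi> (\<tau> ?v \<omega>) = (LINT x|lborel. u x * \<eta> (x - ?v))" .
    have ueq: "f (\<tau> x \<omega>) = u x" for x by (simp add: u_def)
    have "(\<psi> (\<tau> ?v \<omega>) - \<psi> \<omega>) / h - D \<omega>
        = (LINT x|lborel. (u x * \<eta> (x - ?v) - u x * \<eta> x) / h - u x * - g x)"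
      unfolding 1 unfolding D_def \<psi>_def ueq
      using integrable_smear(1)[OF _ shift u] integrable_smear(1)[OF _ int\<eta> u] integrable_smear(1)[OF _ intg u]
      by simp
    also have "\<dots> = (LINT x|lborel. u x * ((\<eta> (x - ?v) - \<eta> x) / h + g x))"
      by (intro Bochner_Integration.integral_cong refl) (simp add: diff_divide_distrib right_diff_distrib distrib_left)
    finally have 2: "(\<psi> (\<tau> ?v \<omega>) - \<psi> \<omega>) / h - D \<omega>
        = (LINT x|lborel. u x * ((\<eta> (x - ?v) - \<eta> x) / h + g x))" .
    have intq: "integrable lborel (\<lambda>x. (\<eta> (x - ?v) - \<eta> x) / h + g x)"
      using shift int\<eta> intg by simp
    have "\<bar>(\<psi> (\<tau> ?v \<omega>) - \<psi> \<omega>) / h - D \<omega>\<bar> \<le> C * (LINT x|lborel. \<bar>(\<eta> (x - ?v) - \<eta> x) / h + g x\<bar>)"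
      unfolding 2 by (intro integrable_smear intq u) auto
    also have "\<dots> \<le> C * (LINT x|lborel. e * indicator (cball (0 :: real ^ 'n) r') x)"
      using C intq intind e by (intro mult_left_mono integral_mono) auto
    also have "\<dots> = C * (e * V)"
      by (simp add: V_def emeasure_lborel_cball_finite)
    finally show ?thesis .
  qed
  have L2: "\<psi> \<in> Lp M 2" "D \<in> Lp M 2"
    unfolding \<psi>_def D_def using smear_Lp_2[OF f int\<eta>] smear_Lp_2[OF f intg] by simp_all
  have "((\<lambda>h. LINT \<omega>|M. ((\<psi> (\<tau> (h *\<^sub>R axis i 1) \<omega>) - \<psi> \<omega>) / h - D \<omega>)\<^sup>2) \<longlongrightarrow> 0) (at 0)"
  proof (rule tendstoI)
    fix e0 :: real assume e0: "e0 > 0"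
    define q where "q = C * V + 1"
    define e where "e = min 1 e0 / (2 * q)"
    have V: "V \<ge> 0" by (simp add: V_def)
    then have CV: "q > 0" using C(1) by (simp add: q_def add_nonneg_pos)
    have e: "e > 0" using CV e0 by (simp add: e_def)
    have Ce: "C * (e * V) \<le> min 1 e0 / 2" "0 \<le> C * (e * V)"
    proof -
      have "C * (e * V) = e * (C * V)" by simp
      also have "\<dots> \<le> e * q" using e by (intro mult_left_mono) (auto simp: q_def)
      also have "\<dots> = min 1 e0 / 2" using CV by (simp add: e_def field_simps)
      finally show "C * (e * V) \<le> min 1 e0 / 2" .
      show "0 \<le> C * (e * V)" using C(1) V e by simp
    qed
    have "(C * (e * V))\<^sup>2 \<le> (C * (e * V)) * 1"
      unfolding power2_eq_square using Ce by (intro mult_left_mono) auto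
    then have sq: "(C * (e * V))\<^sup>2 < e0" using Ce e0 by linarith
    obtain d where d: "d > 0" "\<And>h x. 0 < \<bar>h\<bar> \<Longrightarrow> \<bar>h\<bar> < d \<Longrightarrow>
       \<bar>(\<eta> (x - h *\<^sub>R axis i 1) - \<eta> x) / h + g x\<bar> \<le> e * indicator (cball 0 r') x"
      using r'(2)[OF e] by blast
    have "dist (LINT \<omega>|M. ((\<psi> (\<tau> (h *\<^sub>R axis i 1) \<omega>) - \<psi> \<omega>) / h - D \<omega>)\<^sup>2) 0 < e0"
      if h: "h \<noteq> 0" "dist h 0 < d" for h
    proof -
      have "AE \<omega> in M. ((\<psi> (\<tau> (h *\<^sub>R axis i 1) \<omega>) - \<psi> \<omega>) / h - D \<omega>)\<^sup>2 \<le> (C * (e * V))\<^sup>2"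
        using C(2) AE_space
      proof eventually_elim
        case (elim \<omega>)
        have "\<bar>(\<psi> (\<tau> (h *\<^sub>R axis i 1) \<omega>) - \<psi> \<omega>) / h - D \<omega>\<bar> \<le> C * (e * V)"
          by (rule quot) (use elim h d in auto)
        then show ?case using Ce(2) by (simp flip: abs_le_square_iff)
      qed
      then have "(LINT \<omega>|M. ((\<psi> (\<tau> (h *\<^sub>R axis i 1) \<omega>) - \<psi> \<omega>) / h - D \<omega>)\<^sup>2) \<le> (LINT \<omega>|M. (C * (e * V))\<^sup>2)"
        by (intro integral_mono_AE') auto
      then show ?thesis using sq by (simp add: prob_space)
    qed
    then show "\<forall>\<^sub>F h in at 0. dist (LINT \<omega>|M. ((\<psi> (\<tau> (h *\<^sub>R axis i 1) \<omega>) - \<psi> \<omega>) / h - D \<omega>)\<^sup>2) 0 < e0"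
      unfolding eventually_at using d(1) by (intro exI[of _ d]) auto
  qed
  then have "has_horizontal_derivative M \<tau> i \<psi> D"
    using L2 by (simp add: has_horizontal_derivative_def)
  then show ?thesis unfolding \<psi>_def D_def g_def .
qed

end

context random_environment
begin

lemma has_horizontal_derivativeD:
  assumes "has_horizontal_derivative M \<tau> i \<psi> g"
  shows "\<psi> \<in> borel_measurable M" "g \<in> borel_measurable M"
    "integrable M (\<lambda>\<omega>. (\<psi> \<omega>)\<^sup>2)" "integrable M (\<lambda>\<omega>. (g \<omega>)\<^sup>2)"
    "((\<lambda>h. LINT \<omega>|M. ((\<psi> (\<tau> (h *\<^sub>R axis i 1) \<omega>) - \<psi> \<omega>) / h - g \<omega>)\<^sup>2) \<longlongrightarrow> 0) (at 0)"
  using assms by (auto simp: has_horizontal_derivative_def Lp_2_iff)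

lemma integrable_square_quotient:
  fixes \<psi> :: "'a \<Rightarrow> real"
  assumes [measurable]: "\<psi> \<in> borel_measurable M" and int: "integrable M (\<lambda>\<omega>. (\<psi> \<omega>)\<^sup>2)"
  shows "integrable M (\<lambda>\<omega>. ((\<psi> (\<tau> x \<omega>) - \<psi> \<omega>) / h)\<^sup>2)"
proof -
  have "integrable M (\<lambda>\<omega>. (\<psi> (\<tau> x \<omega>))\<^sup>2)"
    using integrable_tau[of "\<lambda>\<omega>. (\<psi> \<omega>)\<^sup>2" x] int by simp
  then have "integrable M (\<lambda>\<omega>. (\<psi> (\<tau> x \<omega>) - \<psi> \<omega>)\<^sup>2)"
    using int by (intro integrable_square_diff) auto
  then show ?thesis by (simp add: power_divide)
qed

lemma has_horizontal_derivative_unique: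
  assumes g: "has_horizontal_derivative M \<tau> i \<psi> g" and g': "has_horizontal_derivative M \<tau> i \<psi> g'"
  shows "AE \<omega> in M. g \<omega> = g' \<omega>"
proof -
  note G = has_horizontal_derivativeD[OF g] and G' = has_horizontal_derivativeD[OF g']
  note [measurable] = G(1,2) G'(2)
  let ?q = "\<lambda>h \<omega>. (\<psi> (\<tau> (h *\<^sub>R axis i 1) \<omega>) - \<psi> \<omega>) / h"
  define c where "c = (LINT \<omega>|M. (g \<omega> - g' \<omega>)\<^sup>2)"
  have i0: "integrable M (\<lambda>\<omega>. (g \<omega> - g' \<omega>)\<^sup>2)"
    using G G' by (intro integrable_square_diff) auto
  have le: "c \<le> 2 * (LINT \<omega>|M. (?q h \<omega> - g \<omega>)\<^sup>2) + 2 * (LINT \<omega>|M. (?q h \<omega> - g' \<omega>)\<^sup>2)" for h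
  proof -
    have q: "integrable M (\<lambda>\<omega>. (?q h \<omega>)\<^sup>2)" by (intro integrable_square_quotient G)
    have 1: "integrable M (\<lambda>\<omega>. (?q h \<omega> - g \<omega>)\<^sup>2)" and 2: "integrable M (\<lambda>\<omega>. (?q h \<omega> - g' \<omega>)\<^sup>2)"
      using q G G' by (auto intro!: integrable_square_diff)
    have pt: "(a - b)\<^sup>2 \<le> 2 * (e - a)\<^sup>2 + 2 * (e - b)\<^sup>2" for a b e :: real
      using zero_le_power2[of "(e - a) + (e - b)"] by (simp add: power2_eq_square algebra_simps)
    have "c \<le> (LINT \<omega>|M. 2 * (?q h \<omega> - g \<omega>)\<^sup>2 + 2 * (?q h \<omega> - g' \<omega>)\<^sup>2)"
      unfolding c_def using i0 1 2 by (intro integral_mono pt) auto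
    then show ?thesis using 1 2 by simp
  qed
  have "((\<lambda>h. 2 * (LINT \<omega>|M. (?q h \<omega> - g \<omega>)\<^sup>2) + 2 * (LINT \<omega>|M. (?q h \<omega> - g' \<omega>)\<^sup>2))
      \<longlongrightarrow> 2 * 0 + 2 * 0) (at 0)"
    using G(5) G'(5) by (intro tendsto_intros)
  then have "c \<le> 2 * 0 + 2 * 0"
    by (rule tendsto_lowerbound) (use le in auto)
  moreover have "c \<ge> 0" by (simp add: c_def)
  ultimately have "c = 0" by simp
  then have "AE \<omega> in M. (g \<omega> - g' \<omega>)\<^sup>2 = 0"
    unfolding c_def using i0 by (subst (asm) integral_nonneg_eq_0_iff_AE) auto
  then show ?thesis by eventually_elim simp
qed

lemma has_horizontal_derivative_cong:
  assumes "\<And>\<omega>. \<omega> \<in> space M \<Longrightarrow> \<psi> \<omega> = \<psi>' \<omega>"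
  shows "has_horizontal_derivative M \<tau> i \<psi> g \<longleftrightarrow> has_horizontal_derivative M \<tau> i \<psi>' g"
proof -
  have "(LINT \<omega>|M. ((\<psi> (\<tau> x \<omega>) - \<psi> \<omega>) / h - g \<omega>)\<^sup>2) = (LINT \<omega>|M. ((\<psi>' (\<tau> x \<omega>) - \<psi>' \<omega>) / h - g \<omega>)\<^sup>2)" for x h
    using assms tau_space by (intro Bochner_Integration.integral_cong) auto
  moreover have "\<psi> \<in> borel_measurable M \<longleftrightarrow> \<psi>' \<in> borel_measurable M"
    using assms by (intro measurable_cong) auto
  moreover have "integrable M (\<lambda>\<omega>. (\<psi> \<omega>)\<^sup>2) \<longleftrightarrow> integrable M (\<lambda>\<omega>. (\<psi>' \<omega>)\<^sup>2)"
    using assms by (intro Bochner_Integration.integrable_cong) auto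
  ultimately show ?thesis by (simp add: has_horizontal_derivative_def Lp_2_iff)
qed

lemma has_horizontal_derivative_tau:
  assumes g: "has_horizontal_derivative M \<tau> i \<psi> g"
  shows "has_horizontal_derivative M \<tau> i (\<lambda>\<omega>. \<psi> (\<tau> x \<omega>)) (\<lambda>\<omega>. g (\<tau> x \<omega>))"
proof -
  note G = has_horizontal_derivativeD[OF g]
  note [measurable] = G(1,2)
  have "(LINT \<omega>|M. ((\<psi> (\<tau> x (\<tau> (h *\<^sub>R axis i 1) \<omega>)) - \<psi> (\<tau> x \<omega>)) / h - g (\<tau> x \<omega>))\<^sup>2)
      = (LINT \<omega>|M. ((\<psi> (\<tau> (h *\<^sub>R axis i 1) \<omega>) - \<psi> \<omega>) / h - g \<omega>)\<^sup>2)" for h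
  proof -
    have "(LINT \<omega>|M. ((\<psi> (\<tau> x (\<tau> (h *\<^sub>R axis i 1) \<omega>)) - \<psi> (\<tau> x \<omega>)) / h - g (\<tau> x \<omega>))\<^sup>2)
        = (LINT \<omega>|M. ((\<psi> (\<tau> (h *\<^sub>R axis i 1) (\<tau> x \<omega>)) - \<psi> (\<tau> x \<omega>)) / h - g (\<tau> x \<omega>))\<^sup>2)"
      using tau_commute by (intro Bochner_Integration.integral_cong) auto
    also have "\<dots> = (LINT \<omega>|M. ((\<psi> (\<tau> (h *\<^sub>R axis i 1) \<omega>) - \<psi> \<omega>) / h - g \<omega>)\<^sup>2)"
      by (rule integral_tau[of "\<lambda>\<omega>. ((\<psi> (\<tau> (h *\<^sub>R axis i 1) \<omega>) - \<psi> \<omega>) / h - g \<omega>)\<^sup>2"]) measurable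
    finally show ?thesis .
  qed
  then show ?thesis
    using G integrable_tau[of "\<lambda>\<omega>. (\<psi> \<omega>)\<^sup>2" x] integrable_tau[of "\<lambda>\<omega>. (g \<omega>)\<^sup>2" x]
    by (simp add: has_horizontal_derivative_def Lp_2_iff)
qed

lemma test_function_has_horizontal_derivative:
  assumes "\<psi> \<in> test_functions M \<tau>"
  shows "has_horizontal_derivative M \<tau> i \<psi> (horizontal_derivative M \<tau> i \<psi>)"
proof -
  obtain g where "has_horizontal_derivative M \<tau> i \<psi> g"
    using assms smear_has_horizontal_derivative unfolding test_functions_def by blast
  then show ?thesis unfolding horizontal_derivative_def by (rule someI[of "has_horizontal_derivative M \<tau> i \<psi>"])
qed

text \<open>The translate of a test function is again one; \<open>\<psi>'\<close> and \<open>\<psi> \<circ> \<tau> x\<close> are only compared on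
  the space of \<open>M\<close>, outside of which \<open>\<tau>\<close> is unspecified.\<close>

lemma test_function_tau:
  assumes "\<psi> \<in> test_functions M \<tau>"
  obtains \<psi>' where "\<psi>' \<in> test_functions M \<tau>" "\<And>\<omega>. \<omega> \<in> space M \<Longrightarrow> \<psi>' \<omega> = \<psi> (\<tau> x \<omega>)"
proof -
  obtain f \<eta> where \<psi>: "\<psi> = (\<lambda>\<omega>. LINT y|lborel. f (\<tau> y \<omega>) * \<eta> y)" "f \<in> Linfty M" "\<eta> \<in> Cc_infinity"
    using assms unfolding test_functions_def by auto
  have [measurable]: "f \<in> borel_measurable M" using \<psi> by (simp add: Linfty_def)
  obtain C where "AE \<omega> in M. norm (f \<omega>) \<le> C" using \<psi> by (auto simp: Linfty_def)
  then have "AE \<omega> in M. norm (f (\<tau> x \<omega>)) \<le> C" by (rule AE_tau)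
  then have "(\<lambda>\<omega>. f (\<tau> x \<omega>)) \<in> Linfty M" by (auto simp: Linfty_def)
  then have "(\<lambda>\<omega>. LINT y|lborel. f (\<tau> x (\<tau> y \<omega>)) * \<eta> y) \<in> test_functions M \<tau>"
    using \<psi>(3) unfolding test_functions_def
    by (intro CollectI exI[of _ "\<lambda>\<omega>. f (\<tau> x \<omega>)"] exI[of _ \<eta>]) simp
  moreover have "(LINT y|lborel. f (\<tau> x (\<tau> y \<omega>)) * \<eta> y) = \<psi> (\<tau> x \<omega>)" if "\<omega> \<in> space M" for \<omega>
    using tau_commute[OF that, of x] by (simp add: \<psi>(1))
  ultimately show ?thesis by (rule that)
qed

text \<open>A divergence-free field has divergence-free translates: stationarity moves the shift from the
  field onto the test function.\<close>

lemma divergence_free_shift: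
  fixes B :: "'a \<Rightarrow> real ^ 'n"
  assumes [measurable]: "B \<in> borel_measurable M"
    and div: "\<forall>\<psi>\<in>test_functions M \<tau>. divergence M \<tau> B \<psi> = 0"
    and \<psi>: "\<psi> \<in> test_functions M \<tau>"
  shows "(\<Sum>k\<in>UNIV. LINT \<omega>|M. B (\<tau> x \<omega>) $ k * horizontal_derivative M \<tau> k \<psi> \<omega>) = 0"
proof -
  obtain \<psi>' where \<psi>': "\<psi>' \<in> test_functions M \<tau>" "\<And>\<omega>. \<omega> \<in> space M \<Longrightarrow> \<psi>' \<omega> = \<psi> (\<tau> (- x) \<omega>)"
    using test_function_tau[OF \<psi>] by blast
  have "(LINT \<omega>|M. B (\<tau> x \<omega>) $ k * horizontal_derivative M \<tau> k \<psi> \<omega>)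
      = (LINT \<omega>|M. B \<omega> $ k * horizontal_derivative M \<tau> k \<psi>' \<omega>)" for k
  proof -
    define D D' where "D = horizontal_derivative M \<tau> k \<psi>" and "D' = horizontal_derivative M \<tau> k \<psi>'"
    have D: "has_horizontal_derivative M \<tau> k \<psi> D" and D': "has_horizontal_derivative M \<tau> k \<psi>' D'"
      unfolding D_def D'_def by (intro test_function_has_horizontal_derivative \<psi> \<psi>')+
    note [measurable] = has_horizontal_derivativeD(2)[OF D] has_horizontal_derivativeD(2)[OF D']
    have "has_horizontal_derivative M \<tau> k \<psi>' (\<lambda>\<omega>. D (\<tau> (- x) \<omega>))"
      using has_horizontal_derivative_tau[OF D, of "- x"]
        has_horizontal_derivative_cong[of \<psi>' "\<lambda>\<omega>. \<psi> (\<tau> (- x) \<omega>)", OF \<psi>'(2)] by simp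
    then have eq: "AE \<omega> in M. D' \<omega> = D (\<tau> (- x) \<omega>)"
      using has_horizontal_derivative_unique[OF D'] by blast
    have "(LINT \<omega>|M. B (\<tau> x \<omega>) $ k * D \<omega>) = (LINT \<omega>|M. B (\<tau> x (\<tau> (- x) \<omega>)) $ k * D (\<tau> (- x) \<omega>))"
      by (rule integral_tau[symmetric, of "\<lambda>\<omega>. B (\<tau> x \<omega>) $ k * D \<omega>"]) measurable
    also have "\<dots> = (LINT \<omega>|M. B \<omega> $ k * D (\<tau> (- x) \<omega>))"
      using tau_add[of _ x "- x"] tau_zero by (intro Bochner_Integration.integral_cong) auto
    also have "\<dots> = (LINT \<omega>|M. B \<omega> $ k * D' \<omega>)"
      using eq by (intro integral_cong_AE) auto
    finally show ?thesis by (simp add: D_def D'_def)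
  qed
  then show ?thesis
    using div \<psi>'(1) by (simp add: divergence_def dist_derivative_def sum_negf)
qed

lemma weak_horizontal_derivative:
  fixes c :: "'a \<Rightarrow> real"
  assumes D: "has_horizontal_derivative M \<tau> i \<psi> D"
    and [measurable]: "c \<in> borel_measurable M" and c: "integrable M (\<lambda>\<omega>. (c \<omega>)\<^sup>2)"
  shows "((\<lambda>h. LINT \<omega>|M. c \<omega> * ((\<psi> (\<tau> (h *\<^sub>R axis i 1) \<omega>) - \<psi> \<omega>) / h)) \<longlongrightarrow> (LINT \<omega>|M. c \<omega> * D \<omega>)) (at 0)"
proof -
  note G = has_horizontal_derivativeD[OF D]
  note [measurable] = G(1,2)
  let ?q = "\<lambda>h \<omega>. (\<psi> (\<tau> (h *\<^sub>R axis i 1) \<omega>) - \<psi> \<omega>) / h"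
  have le: "\<bar>(LINT \<omega>|M. c \<omega> * ?q h \<omega>) - (LINT \<omega>|M. c \<omega> * D \<omega>)\<bar>
      \<le> ((LINT \<omega>|M. (c \<omega>)\<^sup>2) + 1) * sqrt (LINT \<omega>|M. (?q h \<omega> - D \<omega>)\<^sup>2)" for h
  proof -
    have q: "integrable M (\<lambda>\<omega>. (?q h \<omega>)\<^sup>2)" by (intro integrable_square_quotient G)
    have "(LINT \<omega>|M. c \<omega> * ?q h \<omega>) - (LINT \<omega>|M. c \<omega> * D \<omega>) = (LINT \<omega>|M. c \<omega> * ?q h \<omega> - c \<omega> * D \<omega>)"
      by (intro Bochner_Integration.integral_diff[symmetric] integrable_mult_of_squares q c G) measurable
    also have "\<dots> = (LINT \<omega>|M. c \<omega> * (?q h \<omega> - D \<omega>))" by (simp only: right_diff_distrib)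
    finally have eq: "(LINT \<omega>|M. c \<omega> * ?q h \<omega>) - (LINT \<omega>|M. c \<omega> * D \<omega>) = (LINT \<omega>|M. c \<omega> * (?q h \<omega> - D \<omega>))" .
    have "integrable M (\<lambda>\<omega>. (?q h \<omega> - D \<omega>)\<^sup>2)" by (rule integrable_square_diff[OF _ _ q G(4)]) measurable
    then show ?thesis
      unfolding eq using c by (intro abs_integral_mult_le) auto
  qed
  have "((\<lambda>h. ((LINT \<omega>|M. (c \<omega>)\<^sup>2) + 1) * sqrt (LINT \<omega>|M. (?q h \<omega> - D \<omega>)\<^sup>2))
      \<longlongrightarrow> 0) (at 0)"
    using tendsto_mult_left[OF tendsto_real_sqrt[OF G(5)], of "(LINT \<omega>|M. (c \<omega>)\<^sup>2) + 1"] by simp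
  then have "((\<lambda>h. (LINT \<omega>|M. c \<omega> * ?q h \<omega>) - (LINT \<omega>|M. c \<omega> * D \<omega>)) \<longlongrightarrow> 0) (at 0)"
    by (rule Lim_null_comparison[OF always_eventually, rotated]) (simp only: real_norm_def le simp_thms)
  then show ?thesis by (rule LIM_zero_cancel)
qed

text \<open>Correlations with \<open>\<psi>\<close> are differentiable along each coordinate direction, whatever the
  regularity of \<open>b\<close>: the shift is moved to \<open>\<psi>\<close>, which reverses its sign.\<close>

lemma correlation_has_derivative:
  fixes b :: "'a \<Rightarrow> real"
  assumes D: "has_horizontal_derivative M \<tau> i \<psi> D"
    and [measurable]: "b \<in> borel_measurable M" and b: "integrable M (\<lambda>\<omega>. (b \<omega>)\<^sup>2)"
  shows "((\<lambda>s. LINT \<omega>|M. b (\<tau> (x + s *\<^sub>R axis i 1) \<omega>) * \<psi> \<omega>) has_real_derivative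
    - (LINT \<omega>|M. b (\<tau> (x + s *\<^sub>R axis i 1) \<omega>) * D \<omega>)) (at s)"
proof -
  note G = has_horizontal_derivativeD[OF D]
  note [measurable] = G(1,2)
  define y where "y = x + s *\<^sub>R axis i 1"
  define c where "c = (\<lambda>\<omega>. b (\<tau> y \<omega>))"
  have cm [measurable]: "c \<in> borel_measurable M" unfolding c_def by measurable
  have c: "integrable M (\<lambda>\<omega>. (c \<omega>)\<^sup>2)"
    using integrable_tau[of "\<lambda>\<omega>. (b \<omega>)\<^sup>2" y] b by (simp add: c_def)
  have quot: "((LINT \<omega>|M. b (\<tau> (x + (s + h) *\<^sub>R axis i 1) \<omega>) * \<psi> \<omega>) - (LINT \<omega>|M. b (\<tau> (x + s *\<^sub>R axis i 1) \<omega>) * \<psi> \<omega>)) / h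
      = - (LINT \<omega>|M. c \<omega> * ((\<psi> (\<tau> ((- h) *\<^sub>R axis i 1) \<omega>) - \<psi> \<omega>) / (- h)))" for h
  proof -
    let ?v = "h *\<^sub>R axis i 1 :: real ^ 'n"
    have "(LINT \<omega>|M. b (\<tau> (x + (s + h) *\<^sub>R axis i 1) \<omega>) * \<psi> \<omega>) = (LINT \<omega>|M. b (\<tau> (y + ?v) \<omega>) * \<psi> \<omega>)"
      by (simp add: y_def algebra_simps)
    also have "\<dots> = (LINT \<omega>|M. b (\<tau> (y + ?v) (\<tau> (- ?v) \<omega>)) * \<psi> (\<tau> (- ?v) \<omega>))"
      by (rule integral_tau[symmetric, of "\<lambda>\<omega>. b (\<tau> (y + ?v) \<omega>) * \<psi> \<omega>"]) measurable
    also have "\<dots> = (LINT \<omega>|M. c \<omega> * \<psi> (\<tau> (- ?v) \<omega>))"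
      using tau_add[of _ "y + ?v" "- ?v"] by (intro Bochner_Integration.integral_cong) (auto simp: c_def)
    finally have 1: "(LINT \<omega>|M. b (\<tau> (x + (s + h) *\<^sub>R axis i 1) \<omega>) * \<psi> \<omega>) = (LINT \<omega>|M. c \<omega> * \<psi> (\<tau> (- ?v) \<omega>))" .
    have "integrable M (\<lambda>\<omega>. c \<omega> * \<psi> \<omega>)" using c G by (intro integrable_mult_of_squares) auto
    moreover have "integrable M (\<lambda>\<omega>. c \<omega> * \<psi> (\<tau> (- ?v) \<omega>))"
      using c G integrable_tau[of "\<lambda>\<omega>. (\<psi> \<omega>)\<^sup>2" "- ?v"] by (intro integrable_mult_of_squares) auto
    ultimately have 2: "(LINT \<omega>|M. c \<omega> * \<psi> (\<tau> (- ?v) \<omega>)) - (LINT \<omega>|M. c \<omega> * \<psi> \<omega>)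
        = (LINT \<omega>|M. c \<omega> * (\<psi> (\<tau> (- ?v) \<omega>) - \<psi> \<omega>))"
      by (simp add: right_diff_distrib)
    have 3: "(LINT \<omega>|M. b (\<tau> (x + s *\<^sub>R axis i 1) \<omega>) * \<psi> \<omega>) = (LINT \<omega>|M. c \<omega> * \<psi> \<omega>)"
      by (simp add: c_def y_def)
    show ?thesis unfolding 1 3 2 by simp
  qed
  have "((\<lambda>h. LINT \<omega>|M. c \<omega> * ((\<psi> (\<tau> (h *\<^sub>R axis i 1) \<omega>) - \<psi> \<omega>) / h)) \<longlongrightarrow> (LINT \<omega>|M. c \<omega> * D \<omega>)) (at 0)"
    by (rule weak_horizontal_derivative[OF D cm c])
  moreover have "filterlim uminus (at (0::real)) (at 0)"
    unfolding filterlim_at by (auto simp: eventually_at_filter intro!: tendsto_eq_intros)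
  ultimately have "((\<lambda>h. LINT \<omega>|M. c \<omega> * ((\<psi> (\<tau> ((- h) *\<^sub>R axis i 1) \<omega>) - \<psi> \<omega>) / (- h))) \<longlongrightarrow> (LINT \<omega>|M. c \<omega> * D \<omega>)) (at 0)"
    by (rule filterlim_compose)
  then have "((\<lambda>h. - (LINT \<omega>|M. c \<omega> * ((\<psi> (\<tau> ((- h) *\<^sub>R axis i 1) \<omega>) - \<psi> \<omega>) / (- h)))) \<longlongrightarrow> - (LINT \<omega>|M. c \<omega> * D \<omega>)) (at 0)"
    by (rule tendsto_minus)
  then show ?thesis
    unfolding DERIV_def quot by (simp add: c_def y_def)
qed

end

section \<open>Boxes of lattice points, doubled in one direction at a time\<close>

text \<open>An enumeration of the coordinates.\<close>

definition coord :: "nat \<Rightarrow> 'n::finite"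
  where "coord = (SOME f. bij_betw f {..<CARD('n)} UNIV)"

lemma bij_coord: "bij_betw (coord :: nat \<Rightarrow> 'n::finite) {..<CARD('n)} UNIV"
proof -
  have "\<exists>f :: nat \<Rightarrow> 'n. bij_betw f {..<CARD('n)} UNIV"
    using ex_bij_betw_nat_finite[of "UNIV :: 'n set"] by (simp add: atLeast0LessThan)
  then show ?thesis unfolding coord_def by (rule someI_ex)
qed

text \<open>The coordinate direction in which the box is doubled in step \<open>m\<close>.\<close>

definition grid_dir :: "nat \<Rightarrow> 'n::finite"
  where "grid_dir m = coord (m mod CARD('n))"

text \<open>The side length of the box in direction \<open>grid_dir m\<close> before step \<open>m\<close>. The dimension enters through
  the type argument.\<close>

definition grid_edge :: "real \<Rightarrow> 'n::finite itself \<Rightarrow> nat \<Rightarrow> real"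
  where "grid_edge R _ m = R * 2 ^ (m div CARD('n))"

text \<open>The translation vector of step \<open>m\<close>.\<close>

definition grid_step :: "real \<Rightarrow> nat \<Rightarrow> real ^ 'n::finite"
  where "grid_step R m = grid_edge R TYPE('n) m *\<^sub>R axis (grid_dir m) 1"

text \<open>The box of lattice points, of mesh \<open>R\<close>, after \<open>m\<close> doublings.\<close>

primrec grid :: "real \<Rightarrow> nat \<Rightarrow> (real ^ 'n::finite) set" where
  "grid R 0 = {0}"
| "grid R (Suc m) = grid R m \<union> (\<lambda>z. z + grid_step R m) ` grid R m"

text \<open>The number of doublings of coordinate \<open>r\<close> before step \<open>m\<close> is
  \<open>m div d + (if r < m mod d then 1 else 0)\<close>; this is how it changes in a step.\<close>

lemma div_mod_Suc_exponent:
  fixes m r d :: nat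
  assumes "r < d"
  shows "Suc m div d + (if r < Suc m mod d then 1 else 0) = m div d + (if r \<le> m mod d then 1 else 0)"
proof (cases "Suc (m mod d) = d")
  case True
  then have "Suc m mod d = 0" "Suc m div d = Suc (m div d)" by (simp_all add: mod_Suc div_Suc)
  then show ?thesis using True assms by auto
next
  case False
  have "Suc m mod d = Suc (m mod d)" "Suc m div d = m div d"
    using False by (simp_all add: mod_Suc div_Suc)
  then show ?thesis by simp
qed

lemma grid_coordinates:
  fixes z :: "real ^ 'n::finite"
  assumes "z \<in> grid R m" "r < CARD('n)"
  shows "\<exists>k::nat. z $ coord r = R * real k \<and> k < (2::nat) ^ (m div CARD('n) + (if r < m mod CARD('n) then 1 else 0))"
  using assms
proof (induction m arbitrary: z r)
  case 0
  then show ?case by (intro exI[of _ 0]) auto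
next
  case (Suc m)
  define d where "d = CARD('n)"
  have ex: "Suc m div d + (if r < Suc m mod d then 1 else 0) = m div d + (if r \<le> m mod d then 1 else 0)"
    using Suc.prems(2) by (intro div_mod_Suc_exponent) (simp add: d_def)
  have inj: "coord r = (grid_dir m :: 'n) \<longleftrightarrow> r = m mod d"
    using bij_coord[where 'n='n] Suc.prems(2) unfolding grid_dir_def d_def bij_betw_def
    by (subst inj_on_eq_iff) auto
  consider "z \<in> grid R m" | z' where "z' \<in> grid R m" "z = z' + grid_step R m"
    using Suc.prems(1) by auto
  then show ?case
  proof cases
    case 1
    from Suc.IH[OF this Suc.prems(2), folded d_def] obtain k :: nat
      where k: "z $ coord r = R * real k" "k < (2::nat) ^ (m div d + (if r < m mod d then 1 else 0))" by (elim exE conjE)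
    have "(2::nat) ^ (m div d + (if r < m mod d then 1 else 0)) \<le> 2 ^ (m div d + (if r \<le> m mod d then 1 else 0))"
      by (intro power_increasing) auto
    then have "k < (2::nat) ^ (m div d + (if r \<le> m mod d then 1 else 0))" using k(2) by linarith
    then show ?thesis unfolding d_def[symmetric] ex using k(1) by blast
  next
    case 2
    from Suc.IH[OF 2(1) Suc.prems(2), folded d_def] obtain k :: nat
      where k: "z' $ coord r = R * real k" "k < (2::nat) ^ (m div d + (if r < m mod d then 1 else 0))" by (elim exE conjE)
    show ?thesis
    proof (cases "r = m mod d")
      case True
      then have "z $ coord r = R * real (k + 2 ^ (m div d))"
        using inj k(1) by (simp add: 2(2) grid_step_def grid_edge_def axis_def d_def algebra_simps)
      moreover have "k + 2 ^ (m div d) < (2::nat) ^ (m div d + (if r \<le> m mod d then 1 else 0))"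
        using k(2) True by simp
      ultimately show ?thesis unfolding d_def[symmetric] ex by blast
    next
      case False
      then have "z $ coord r = R * real k"
        using inj k(1) by (simp add: 2(2) grid_step_def axis_def)
      moreover have "k < (2::nat) ^ (m div d + (if r \<le> m mod d then 1 else 0))"
        using k(2) False by (auto split: if_splits)
      ultimately show ?thesis unfolding d_def[symmetric] ex by blast
    qed
  qed
qed

lemma finite_grid: "finite (grid R m)"
  by (induction m) auto

lemma grid_step_disjoint:
  assumes R: "R > 0"
  shows "grid R m \<inter> (\<lambda>z. z + grid_step R m) ` grid R m = ({} :: (real ^ 'n::finite) set)"
proof -
  have False if zz: "z \<in> grid R m" "z + grid_step R m \<in> grid R m" for z :: "real ^ 'n"
  proof -
    let ?r = "m mod CARD('n)"
    have r: "?r < CARD('n)" by simp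
    obtain k :: nat where k: "z $ coord ?r = R * real k"
      using grid_coordinates[OF zz(1) r] by auto
    obtain k' :: nat where k': "(z + grid_step R m) $ coord ?r = R * real k'" "k' < (2::nat) ^ (m div CARD('n))"
      using grid_coordinates[OF zz(2) r] by auto
    have "R * k' = R * real (k + 2 ^ (m div CARD('n)))"
      using k k'(1) by (simp add: grid_step_def grid_edge_def grid_dir_def axis_def algebra_simps)
    then have "real k' = real (k + 2 ^ (m div CARD('n)))" using R by simp
    then show False using k'(2) by (simp only: of_nat_eq_iff)
  qed
  then show ?thesis by auto
qed

lemma card_grid:
  assumes "R > 0"
  shows "card (grid R m :: (real ^ 'n::finite) set) = 2 ^ m"
proof (induction m)
  case (Suc m)
  have "card (grid R (Suc m) :: (real ^ 'n) set) = card (grid R m :: (real ^ 'n) set)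
      + card ((\<lambda>z. z + grid_step R m) ` (grid R m :: (real ^ 'n) set))"
    using grid_step_disjoint[OF assms, of m, where 'n='n] by (simp add: card_Un_disjoint finite_grid)
  also have "card ((\<lambda>z. z + grid_step R m) ` (grid R m :: (real ^ 'n) set)) = card (grid R m :: (real ^ 'n) set)"
    by (intro card_image) (auto simp: inj_on_def)
  finally show ?case using Suc by simp
qed simp

lemma grid_separated:
  fixes y z :: "real ^ 'n::finite"
  assumes R: "R > 0" and yz: "y \<in> grid R m" "z \<in> grid R m" "y \<noteq> z"
  shows "R \<le> dist y z"
proof -
  obtain i where i: "y $ i \<noteq> z $ i" using yz(3) by (auto simp: vec_eq_iff)
  obtain r where r: "r < CARD('n)" "i = coord r"
    using bij_coord[where 'n='n] unfolding bij_betw_def by (metis UNIV_I imageE lessThan_iff)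
  obtain k k' :: nat where k: "y $ i = R * real k" "z $ i = R * real k'"
    using grid_coordinates[OF yz(1) r(1)] grid_coordinates[OF yz(2) r(1)] r(2) by auto
  have "k \<noteq> k'" using i k by auto
  then have "\<bar>real k - real k'\<bar> \<ge> 1" by (cases "k < k'") auto
  then have "R * 1 \<le> R * \<bar>real k - real k'\<bar>" using R by (intro mult_left_mono) auto
  also have "\<dots> = \<bar>(y - z) $ i\<bar>"
    using R by (simp add: k abs_mult flip: right_diff_distrib)
  also have "\<dots> \<le> dist y z" unfolding dist_norm by (rule component_le_norm_cart)
  finally show ?thesis by simp
qed

text \<open>The average of a function over the box.\<close>

definition grid_avg :: "real \<Rightarrow> nat \<Rightarrow> (real ^ 'n::finite \<Rightarrow> real) \<Rightarrow> real"
  where "grid_avg R m h = (\<Sum>z\<in>grid R m. h z) / 2 ^ m"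

lemma grid_avg_0: "grid_avg R 0 h = h 0"
  by (simp add: grid_avg_def)

lemma grid_avg_Suc:
  fixes h :: "real ^ 'n::finite \<Rightarrow> real"
  assumes "R > 0"
  shows "grid_avg R (Suc m) h = (grid_avg R m h + grid_avg R m (\<lambda>z. h (z + grid_step R m))) / 2"
proof -
  have "(\<Sum>z\<in>grid R (Suc m). h z) = (\<Sum>z\<in>grid R m. h z) + (\<Sum>z\<in>(\<lambda>z. z + grid_step R m) ` grid R m. h z)"
    using grid_step_disjoint[OF assms, of m, where 'n='n] by (simp add: sum.union_disjoint finite_grid)
  also have "(\<Sum>z\<in>(\<lambda>z. z + grid_step R m) ` grid R m. h z) = (\<Sum>z\<in>grid R m. h (z + grid_step R m))"
    by (subst sum.reindex) (auto simp: inj_on_def)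
  finally show ?thesis by (simp add: grid_avg_def add_divide_distrib)
qed

section \<open>Averages and series of random variables\<close>

text \<open>Lebesgue measure on the unit interval, as a probability measure on the real line.\<close>

definition unit_measure :: "real measure"
  where "unit_measure = density lborel (\<lambda>s. ennreal (indicator {0..1} s))"

lemma sets_unit_measure [measurable_cong, simp]: "sets unit_measure = sets borel"
  by (simp add: unit_measure_def)

lemma prob_space_unit_measure: "prob_space unit_measure"
proof
  have "emeasure unit_measure (space unit_measure) = (\<integral>\<^sup>+ s. indicator {0..1::real} s \<partial>lborel)"
    unfolding unit_measure_def by (subst emeasure_density) (auto simp: ennreal_indicator)
  then show "emeasure unit_measure (space unit_measure) = 1" by simp
qed

text \<open>Only integrability of the derivative is assumed, not its continuity.\<close>

lemma unit_measure_FTC: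
  fixes F f :: "real \<Rightarrow> real"
  assumes F: "\<And>s. (F has_real_derivative f s) (at s)" and f: "integrable unit_measure f"
  shows "(LINT s|unit_measure. f s) = F 1 - F 0"
proof -
  have [measurable]: "f \<in> borel_measurable borel" using borel_measurable_integrable[OF f] by (simp cong: measurable_cong_sets)
  have si: "set_integrable lborel {0..1} f"
    using f unfolding unit_measure_def set_integrable_def
    by (subst (asm) integrable_density) auto
  have "(LINT s|unit_measure. f s) = (LINT s:{0..1}|lborel. f s)"
    unfolding unit_measure_def set_lebesgue_integral_def by (subst integral_density) auto
  also have "\<dots> = integral {0..1} f" by (rule set_borel_integral_eq_integral[OF si])
  also have "(f has_integral (F 1 - F 0)) {0..1}"
    using F by (intro fundamental_theorem_of_calculus)
       (auto simp: has_real_derivative_iff_has_vector_derivative intro: has_vector_derivative_at_within)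
  then have "integral {0..1} f = F 1 - F 0" by (rule integral_unique)
  finally show ?thesis .
qed

text \<open>Moment bounds that are uniform in a parameter are inherited by the average over the parameter,
  and the average may be tested against square-integrable functions under the integral sign.\<close>

lemma averaged_moment:
  fixes f :: "'s \<Rightarrow> 'a \<Rightarrow> real" and C p :: real
  assumes U: "prob_space U" and M: "prob_space M"
    and [measurable]: "case_prod f \<in> borel_measurable (U \<Otimes>\<^sub>M M)"
    and int: "\<And>s. s \<in> space U \<Longrightarrow> integrable M (\<lambda>\<omega>. \<bar>f s \<omega>\<bar> powr p)"
    and le: "\<And>s. s \<in> space U \<Longrightarrow> (LINT \<omega>|M. \<bar>f s \<omega>\<bar> powr p) \<le> C"
    and p: "p \<ge> 2"
  defines "F \<equiv> \<lambda>\<omega>. LINT s|U. f s \<omega>"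
  shows "F \<in> borel_measurable M"
    and "integrable M (\<lambda>\<omega>. \<bar>F \<omega>\<bar> powr p)"
    and "(LINT \<omega>|M. \<bar>F \<omega>\<bar> powr p) \<le> 2 powr p * C"
    and "\<And>h. h \<in> borel_measurable M \<Longrightarrow> integrable M (\<lambda>\<omega>. (h \<omega>)\<^sup>2) \<Longrightarrow>
      integrable U (\<lambda>s. LINT \<omega>|M. f s \<omega> * h \<omega>) \<and>
      (LINT \<omega>|M. F \<omega> * h \<omega>) = (LINT s|U. LINT \<omega>|M. f s \<omega> * h \<omega>)"
proof -
  interpret U: prob_space U by fact
  interpret M: prob_space M by fact
  interpret P: pair_prob_space U M by unfold_locales
  have [measurable]: "\<And>s. s \<in> space U \<Longrightarrow> f s \<in> borel_measurable M" by measurable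
  have intp: "integrable (U \<Otimes>\<^sub>M M) (\<lambda>(s, \<omega>). \<bar>f s \<omega>\<bar> powr p)"
  proof (rule P.Fubini_integrable)
    show "integrable U (\<lambda>s. LINT \<omega>|M. norm (case (s, \<omega>) of (s, \<omega>) \<Rightarrow> \<bar>f s \<omega>\<bar> powr p))"
      by (rule U.integrable_const_bound[of _ C]) (use le in auto)
  qed (use int in auto)
  have AEi: "AE \<omega> in M. integrable U (\<lambda>s. \<bar>f s \<omega>\<bar> powr p)"
    using P.AE_integrable_snd[OF intp] by simp
  show Fm [measurable]: "F \<in> borel_measurable M"
    unfolding F_def by (rule U.borel_measurable_lebesgue_integral) measurable
  have G: "integrable M (\<lambda>\<omega>. LINT s|U. \<bar>f s \<omega>\<bar> powr p)"
    using P.integrable_snd[OF intp] by simp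
  have Gle: "(LINT \<omega>|M. LINT s|U. \<bar>f s \<omega>\<bar> powr p) \<le> C"
  proof -
    have "(LINT \<omega>|M. LINT s|U. \<bar>f s \<omega>\<bar> powr p) = (LINT s|U. LINT \<omega>|M. \<bar>f s \<omega>\<bar> powr p)"
      using P.Fubini_integral[OF intp] by simp
    also have "\<dots> \<le> (LINT s|U. C)"
      using P.integrable_fst[OF intp] le by (intro integral_mono) auto
    finally show ?thesis by (simp add: U.prob_space)
  qed
  have pt: "AE \<omega> in M. \<bar>F \<omega>\<bar> powr p \<le> 2 powr p * (LINT s|U. \<bar>f s \<omega>\<bar> powr p)"
    using AEi AE_space
  proof eventually_elim
    case (elim \<omega>)
    have [measurable]: "(\<lambda>s. f s \<omega>) \<in> borel_measurable U" using elim by measurable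
    show ?case unfolding F_def by (rule powr_integral_le[OF U _ elim(1)]) (use p in auto)
  qed
  show Fi: "integrable M (\<lambda>\<omega>. \<bar>F \<omega>\<bar> powr p)"
    by (rule Bochner_Integration.integrable_bound[of M "\<lambda>\<omega>. 2 powr p * (LINT s|U. \<bar>f s \<omega>\<bar> powr p)"])
       (use G pt in auto)
  have "(LINT \<omega>|M. \<bar>F \<omega>\<bar> powr p) \<le> (LINT \<omega>|M. 2 powr p * (LINT s|U. \<bar>f s \<omega>\<bar> powr p))"
    using Fi G pt by (intro integral_mono_AE) auto
  also have "\<dots> \<le> 2 powr p * C" using Gle by (simp add: mult_left_mono)
  finally show "(LINT \<omega>|M. \<bar>F \<omega>\<bar> powr p) \<le> 2 powr p * C" .
  fix h :: "'a \<Rightarrow> real" assume h [measurable]: "h \<in> borel_measurable M" and h2: "integrable M (\<lambda>\<omega>. (h \<omega>)\<^sup>2)"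
  have hh: "integrable (U \<Otimes>\<^sub>M M) (\<lambda>z. (h (snd z))\<^sup>2)"
    using P.integrable_product_swap_iff[of "\<lambda>z. (h (snd z))\<^sup>2"] h2
    by (intro P.Fubini_integrable) auto
  have ff: "integrable (U \<Otimes>\<^sub>M M) (\<lambda>z. (case_prod f z)\<^sup>2)"
    using intp p P.prob_space_axioms by (intro integrable_square_of_powr) (auto simp: case_prod_unfold)
  have fh: "integrable (U \<Otimes>\<^sub>M M) (\<lambda>z. case_prod f z * h (snd z))"
    using ff hh by (intro integrable_mult_of_squares) auto
  then have fh': "integrable (U \<Otimes>\<^sub>M M) (\<lambda>(s, \<omega>). f s \<omega> * h \<omega>)"
    by (simp add: case_prod_unfold)
  show "integrable U (\<lambda>s. LINT \<omega>|M. f s \<omega> * h \<omega>) \<and>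
      (LINT \<omega>|M. F \<omega> * h \<omega>) = (LINT s|U. LINT \<omega>|M. f s \<omega> * h \<omega>)"
    using P.integrable_fst[OF fh'] P.Fubini_integral[OF fh'] by (simp add: F_def)
qed

text \<open>A series whose terms have \<open>L\<^sup>p\<close> norms of order \<open>\<rho>^m\<close> converges almost surely to an
  element of \<open>L\<^sup>p\<close>, and may be tested term by term against square-integrable functions. With
  \<open>w = \<rho>^(1/2)\<close>, the random variable \<open>Z = \<Sum>m. (|F m| / w^m)^p\<close> is integrable and
  \<open>|F m| \<le> Z^(1/p) w^m\<close>, which dominates the series by a geometric one.\<close>

lemma moment_series:
  fixes F :: "nat \<Rightarrow> 'a \<Rightarrow> real" and C p \<rho> :: real
  assumes M: "prob_space M" and Fm [measurable]: "\<And>m. F m \<in> borel_measurable M"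
    and int: "\<And>m. integrable M (\<lambda>\<omega>. \<bar>F m \<omega>\<bar> powr p)"
    and le: "\<And>m. (LINT \<omega>|M. \<bar>F m \<omega>\<bar> powr p) \<le> C * (\<rho> ^ m) powr p"
    and p: "p \<ge> 2" and \<rho>: "0 < \<rho>" "\<rho> < 1"
  shows "AE \<omega> in M. summable (\<lambda>m. F m \<omega>)"
    and "integrable M (\<lambda>\<omega>. \<bar>\<Sum>m. F m \<omega>\<bar> powr p)"
    and "\<And>h. h \<in> borel_measurable M \<Longrightarrow> integrable M (\<lambda>\<omega>. (h \<omega>)\<^sup>2) \<Longrightarrow>
      (\<lambda>m. LINT \<omega>|M. F m \<omega> * h \<omega>) sums (LINT \<omega>|M. (\<Sum>m. F m \<omega>) * h \<omega>)"
proof -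
  interpret prob_space M by fact
  define w where "w = sqrt \<rho>"
  have w: "0 < w" "w < 1" "w * w = \<rho>" using \<rho> by (simp_all add: w_def)
  define q where "q = w powr p"
  have q: "0 < q" "q < 1" using w p powr_less_mono2[of p w 1] by (auto simp: q_def)
  define T where "T = (\<lambda>m \<omega>. \<bar>F m \<omega>\<bar> powr p / q ^ m)"
  have Tm [measurable]: "T m \<in> borel_measurable M" for m unfolding T_def by measurable
  have T0: "T m \<omega> \<ge> 0" for m \<omega> using q by (simp add: T_def)
  have Ti: "integrable M (T m)" for m unfolding T_def using int by auto
  have C0: "C \<ge> 0"
  proof -
    have "0 \<le> (LINT \<omega>|M. \<bar>F 0 \<omega>\<bar> powr p)" by simp
    also have "\<dots> \<le> C" using le[of 0] by simp
    finally show ?thesis .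
  qed
  have wq: "(w ^ m) powr p = q ^ m" for m
    using w by (induction m) (auto simp: q_def powr_mult)
  have Tle: "(LINT \<omega>|M. T m \<omega>) \<le> C * q ^ m" for m
  proof -
    have "(\<rho> ^ m) powr p = q ^ m * q ^ m"
      using w wq[of m] by (simp add: w(3)[symmetric] power_mult_distrib powr_mult)
    then have "(LINT \<omega>|M. \<bar>F m \<omega>\<bar> powr p) / q ^ m \<le> C * q ^ m"
      using le[of m] q by (simp add: divide_le_eq)
    then show ?thesis by (simp add: T_def)
  qed
  have Tsum: "summable (\<lambda>m. LINT \<omega>|M. T m \<omega>)"
  proof (rule summable_comparison_test)
    show "summable (\<lambda>m. C * q ^ m)" using q by (intro summable_mult summable_geometric) auto
    show "\<exists>N. \<forall>m\<ge>N. norm (LINT \<omega>|M. T m \<omega>) \<le> C * q ^ m"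
      using Tle T0 by (auto intro!: Bochner_Integration.integral_nonneg)
  qed
  have Tfin: "AE \<omega> in M. summable (\<lambda>m. T m \<omega>)"
  proof -
    have "(\<integral>\<^sup>+\<omega>. (\<Sum>m. ennreal (T m \<omega>)) \<partial>M) = (\<Sum>m. \<integral>\<^sup>+\<omega>. ennreal (T m \<omega>) \<partial>M)"
      by (rule nn_integral_suminf) auto
    also have "\<dots> = (\<Sum>m. ennreal (LINT \<omega>|M. T m \<omega>))"
      using Ti T0 by (simp add: nn_integral_eq_integral)
    also have "\<dots> = ennreal (\<Sum>m. LINT \<omega>|M. T m \<omega>)"
      using Tsum T0 by (intro suminf_ennreal2) (auto intro!: Bochner_Integration.integral_nonneg)
    finally have "(\<integral>\<^sup>+\<omega>. (\<Sum>m. ennreal (T m \<omega>)) \<partial>M) \<noteq> \<infinity>" by simp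
    then have "AE \<omega> in M. (\<Sum>m. ennreal (T m \<omega>)) \<noteq> \<infinity>"
      by (intro nn_integral_PInf_AE) auto
    then show ?thesis
      by eventually_elim (use T0 in \<open>auto intro!: summable_suminf_not_top\<close>)
  qed
  define Z where "Z = (\<lambda>\<omega>. \<Sum>m. T m \<omega>)"
  have Zm [measurable]: "Z \<in> borel_measurable M" unfolding Z_def by measurable
  have Zi: "integrable M Z"
    unfolding Z_def using Ti Tfin Tsum T0 by (intro integrable_suminf) auto
  have bound: "AE \<omega> in M. 0 \<le> Z \<omega> \<and> (\<forall>m. \<bar>F m \<omega>\<bar> \<le> Z \<omega> powr (1 / p) * w ^ m)"
    using Tfin
  proof eventually_elim
    case (elim \<omega>)
    have Z0: "0 \<le> Z \<omega>" unfolding Z_def using elim T0 by (intro suminf_nonneg) auto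
    have "\<bar>F m \<omega>\<bar> \<le> Z \<omega> powr (1 / p) * w ^ m" for m
    proof -
      have "T m \<omega> \<le> Z \<omega>"
        unfolding Z_def using sum_le_suminf[OF elim, of "{m}"] T0 by auto
      then have "\<bar>F m \<omega>\<bar> powr p \<le> Z \<omega> * q ^ m" using q by (simp add: T_def divide_le_eq)
      then have "(\<bar>F m \<omega>\<bar> powr p) powr (1 / p) \<le> (Z \<omega> * q ^ m) powr (1 / p)"
        using p by (intro powr_mono2) auto
      moreover have "(\<bar>F m \<omega>\<bar> powr p) powr (1 / p) = \<bar>F m \<omega>\<bar>"
        using p by (simp add: powr_powr)
      moreover have "(q ^ m) powr (1 / p) = w ^ m"
        using w p by (simp add: wq[symmetric] powr_powr)
      ultimately show ?thesis by (simp add: powr_mult)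
    qed
    then show ?case using Z0 by auto
  qed
  have geo: "summable (\<lambda>m. a * w ^ m)" for a using w by (intro summable_mult summable_geometric) auto
  show sF: "AE \<omega> in M. summable (\<lambda>m. F m \<omega>)"
    using bound
  proof eventually_elim
    case (elim \<omega>)
    then show ?case
      by (intro summable_comparison_test[OF _ geo[of "Z \<omega> powr (1 / p)"]]) auto
  qed
  define W where "W = (1 / (1 - w)) powr p"
  have Fle: "AE \<omega> in M. \<bar>\<Sum>m. F m \<omega>\<bar> powr p \<le> W * Z \<omega>"
    using bound
  proof eventually_elim
    case (elim \<omega>)
    have sn: "summable (\<lambda>m. \<bar>F m \<omega>\<bar>)"
      using elim by (intro summable_comparison_test[OF _ geo[of "Z \<omega> powr (1 / p)"]]) auto
    have "\<bar>\<Sum>m. F m \<omega>\<bar> \<le> (\<Sum>m. \<bar>F m \<omega>\<bar>)" by (rule summable_rabs[OF sn])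
    also have "\<dots> \<le> (\<Sum>m. Z \<omega> powr (1 / p) * w ^ m)"
      using elim by (intro suminf_le sn geo) auto
    also have "\<dots> = Z \<omega> powr (1 / p) * (1 / (1 - w))"
      using w by (subst suminf_mult) (auto simp: suminf_geometric summable_geometric)
    finally have "\<bar>\<Sum>m. F m \<omega>\<bar> powr p \<le> (Z \<omega> powr (1 / p) * (1 / (1 - w))) powr p"
      using p by (intro powr_mono2) auto
    also have "\<dots> = W * Z \<omega>"
      unfolding W_def powr_mult using elim p by (simp add: powr_powr)
    finally show ?case .
  qed
  have Fsm [measurable]: "(\<lambda>\<omega>. \<Sum>m. F m \<omega>) \<in> borel_measurable M" by measurable
  show "integrable M (\<lambda>\<omega>. \<bar>\<Sum>m. F m \<omega>\<bar> powr p)"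
    by (rule Bochner_Integration.integrable_bound[of M "\<lambda>\<omega>. W * Z \<omega>"])
       (use Zi Fle in \<open>auto elim!: eventually_mono intro: order_trans\<close>)
  fix h :: "'a \<Rightarrow> real" assume h [measurable]: "h \<in> borel_measurable M" and h2: "integrable M (\<lambda>\<omega>. (h \<omega>)\<^sup>2)"
  define E where "E = (\<lambda>\<omega>. 1 + Z \<omega> + (h \<omega>)\<^sup>2)"
  have Ei: "integrable M E" unfolding E_def using Zi h2 by auto
  have pt: "AE \<omega> in M. \<forall>m. \<bar>F m \<omega> * h \<omega>\<bar> \<le> E \<omega> * w ^ m"
    using bound
  proof eventually_elim
    case (elim \<omega>)
    define r where "r = Z \<omega> powr (1 / p)"
    have "r * \<bar>h \<omega>\<bar> \<le> r\<^sup>2 + (h \<omega>)\<^sup>2"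
      using sum_squares_bound[of r "\<bar>h \<omega>\<bar>"] zero_le_power2[of r] zero_le_power2[of "h \<omega>"] by (simp, linarith)
    moreover have "r\<^sup>2 \<le> 1 + Z \<omega>"
    proof -
      have "\<bar>r\<bar> powr 2 \<le> 1 + \<bar>r\<bar> powr p" using p by (intro abs_le_one_plus_powr) auto
      moreover have "\<bar>r\<bar> powr p = Z \<omega>" using elim p by (simp add: r_def powr_powr)
      ultimately show ?thesis by (simp add: powr_numeral)
    qed
    ultimately have rE: "r * \<bar>h \<omega>\<bar> \<le> E \<omega>" by (simp add: E_def)
    have "\<bar>F m \<omega> * h \<omega>\<bar> \<le> E \<omega> * w ^ m" for m
    proof -
      have "\<bar>F m \<omega> * h \<omega>\<bar> \<le> (r * w ^ m) * \<bar>h \<omega>\<bar>"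
        unfolding abs_mult using elim by (intro mult_right_mono) (auto simp: r_def)
      also have "\<dots> = (r * \<bar>h \<omega>\<bar>) * w ^ m" by simp
      also have "\<dots> \<le> E \<omega> * w ^ m" using rE w by (intro mult_right_mono) auto
      finally show ?thesis .
    qed
    then show ?case by blast
  qed
  have Fhi: "integrable M (\<lambda>\<omega>. F m \<omega> * h \<omega>)" for m
    by (intro integrable_mult_of_squares integrable_square_of_powr[OF M Fm int p] h2) measurable
  have "(\<lambda>m. LINT \<omega>|M. F m \<omega> * h \<omega>) sums (LINT \<omega>|M. (\<Sum>m. F m \<omega> * h \<omega>))"
  proof (rule sums_integral[OF Fhi])
    show "AE \<omega> in M. summable (\<lambda>m. norm (F m \<omega> * h \<omega>))"
      using pt
    proof eventually_elim
      case (elim \<omega>)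
      then show ?case by (intro summable_comparison_test[OF _ geo[of "E \<omega>"]]) auto
    qed
    show "summable (\<lambda>m. LINT \<omega>|M. norm (F m \<omega> * h \<omega>))"
    proof (rule summable_comparison_test[OF _ geo[of "LINT \<omega>|M. E \<omega>"]], intro exI allI impI)
      fix m
      have "(LINT \<omega>|M. norm (F m \<omega> * h \<omega>)) \<le> (LINT \<omega>|M. E \<omega> * w ^ m)"
        using Fhi Ei pt by (intro integral_mono_AE) auto
      then show "norm (LINT \<omega>|M. norm (F m \<omega> * h \<omega>)) \<le> (LINT \<omega>|M. E \<omega>) * w ^ m" by simp
    qed
  qed
  also have "(LINT \<omega>|M. (\<Sum>m. F m \<omega> * h \<omega>)) = (LINT \<omega>|M. (\<Sum>m. F m \<omega>) * h \<omega>)"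
  proof (rule integral_cong_AE)
    show "AE \<omega> in M. (\<Sum>m. F m \<omega> * h \<omega>) = (\<Sum>m. F m \<omega>) * h \<omega>"
      using sF by eventually_elim (rule suminf_mult2[symmetric])
  qed measurable
  finally show "(\<lambda>m. LINT \<omega>|M. F m \<omega> * h \<omega>) sums (LINT \<omega>|M. (\<Sum>m. F m \<omega>) * h \<omega>)" .
qed

section \<open>The stream matrix\<close>

text \<open>The spatial average of the \<open>j\<close>-th component of the field over the box.\<close>

definition grid_mean ::
  "(real ^ 'n::finite \<Rightarrow> 'a \<Rightarrow> 'a) \<Rightarrow> ('a \<Rightarrow> real ^ 'n) \<Rightarrow> real \<Rightarrow> nat \<Rightarrow> 'n \<Rightarrow> 'a \<Rightarrow> real"
  where "grid_mean \<tau> B R m j \<omega> = grid_avg R m (\<lambda>z. B (\<tau> z \<omega>) $ j)"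

text \<open>The skew-symmetric matrix whose integral over \<open>s \<in> [0, 1]\<close> is the contribution of step \<open>m\<close> to the
  stream matrix: the box is moved along the segment of length \<open>grid_edge\<close> in direction \<open>grid_dir m\<close>. The
  factor 1/2 is the share of the translated half in the doubled box.\<close>

definition flux ::
  "(real ^ 'n::finite \<Rightarrow> 'a \<Rightarrow> 'a) \<Rightarrow> ('a \<Rightarrow> real ^ 'n) \<Rightarrow> real \<Rightarrow> nat \<Rightarrow> 'n \<Rightarrow> 'n \<Rightarrow> real \<Rightarrow> 'a \<Rightarrow> real"
  where "flux \<tau> B R m j k s \<omega> = grid_edge R TYPE('n) m / 2 *
    ((if j = grid_dir m then grid_mean \<tau> B R m k (\<tau> (s *\<^sub>R grid_step R m) \<omega>) else 0)
     - (if k = grid_dir m then grid_mean \<tau> B R m j (\<tau> (s *\<^sub>R grid_step R m) \<omega>) else 0))"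

text \<open>The contribution of step \<open>m\<close> to the stream matrix.\<close>

definition stream_increment ::
  "(real ^ 'n::finite \<Rightarrow> 'a \<Rightarrow> 'a) \<Rightarrow> ('a \<Rightarrow> real ^ 'n) \<Rightarrow> real \<Rightarrow> nat \<Rightarrow> 'n \<Rightarrow> 'n \<Rightarrow> 'a \<Rightarrow> real"
  where "stream_increment \<tau> B R m j k \<omega> = (LINT s|unit_measure. flux \<tau> B R m j k s \<omega>)"

lemma flux_skew: "flux \<tau> B R m k j s \<omega> = - flux \<tau> B R m j k s \<omega>"
  by (simp add: flux_def algebra_simps)

lemma stream_increment_skew: "stream_increment \<tau> B R m k j \<omega> = - stream_increment \<tau> B R m j k \<omega>"
  by (simp add: stream_increment_def flux_skew[of \<tau> B R m k j])

lemma sqrt_half_power: "sqrt (1 / 2) ^ m = (2 ^ m) powr (- (1 / 2))"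
proof -
  have "sqrt (1 / 2) ^ m = 1 / sqrt (2 ^ m)"
    by (simp add: real_sqrt_divide real_sqrt_power power_divide)
  also have "sqrt (2 ^ m) = (2 ^ m) powr (1 / 2)"
    by (rule powr_half_sqrt[symmetric]) simp
  finally show ?thesis by (simp only: powr_minus_divide)
qed

text \<open>The only place where \<open>d \<ge> 3\<close> matters: \<open>2^(m / d - m / 2)\<close> decays, at worst with rate \<open>2^(-1/6)\<close>.\<close>

lemma edge_decay:
  assumes d: "CARD('n::finite) \<ge> 3" and R: "R > 0"
  shows "grid_edge R TYPE('n) m * sqrt (1 / 2) ^ m \<le> R * (2 powr (- 1 / 6)) ^ m"
proof -
  have "m div CARD('n) \<le> m div 3" using d by (intro div_le_mono2) auto
  then have "3 * (m div CARD('n)) \<le> m" by linarith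
  then have "real (m div CARD('n)) \<le> real m / 3" by linarith
  then have "(2::real) ^ (m div CARD('n)) \<le> 2 powr (real m / 3)"
    by (simp flip: powr_realpow)
  moreover have "sqrt (1 / 2) ^ m = 2 powr (- (real m / 2))"
    unfolding sqrt_half_power by (simp add: powr_powr flip: powr_realpow)
  ultimately have "2 ^ (m div CARD('n)) * sqrt (1 / 2) ^ m \<le> 2 powr (real m / 3) * 2 powr (- (real m / 2))"
    by (simp add: mult_right_mono)
  also have "\<dots> = (2 powr (- 1 / 6)) ^ m"
    by (simp add: powr_power flip: powr_add)
  finally show ?thesis using R by (simp add: grid_edge_def mult.assoc)
qed

context random_environment
begin

lemma borel_measurable_grid_mean [measurable (raw)]:
  assumes [measurable]: "B \<in> borel_measurable M" "X \<in> measurable N M"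
  shows "(\<lambda>z. grid_mean \<tau> B R m j (X z)) \<in> borel_measurable N"
  unfolding grid_mean_def grid_avg_def by measurable

lemma grid_mean_moment:
  assumes B [measurable]: "B \<in> borel_measurable M"
    and R: "R > 0" and frd: "finite_range_dependence M \<tau> B R" and p: "p \<ge> 2"
    and int: "integrable M (\<lambda>\<omega>. \<bar>B \<omega> $ j\<bar> powr p)" and mean: "(LINT \<omega>|M. B \<omega> $ j) = 0"
  shows "integrable M (\<lambda>\<omega>. \<bar>grid_mean \<tau> B R m j (\<tau> x \<omega>)\<bar> powr p)" (is ?int)
    and "(LINT \<omega>|M. \<bar>grid_mean \<tau> B R m j (\<tau> x \<omega>)\<bar> powr p)
      \<le> moment_const p powr (p / 2) * (LINT \<omega>|M. \<bar>B \<omega> $ j\<bar> powr p) * (sqrt (1 / 2) ^ m) powr p" (is ?le)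
proof -
  define \<beta> where "\<beta> = (LINT \<omega>|M. \<bar>B \<omega> $ j\<bar> powr p)"
  define t where "t = (2::real) ^ m"
  have t: "t > 0" by (simp add: t_def)
  note sum = moment_sum_separated[where P = "grid R m", OF B frd p int mean finite_grid grid_separated[OF R, of _ m]]
  have eq: "\<bar>grid_mean \<tau> B R m j \<omega>\<bar> powr p = \<bar>\<Sum>z\<in>grid R m. B (\<tau> z \<omega>) $ j\<bar> powr p / t powr p" for \<omega>
    using t by (simp add: grid_mean_def grid_avg_def t_def powr_divide)
  have i0: "integrable M (\<lambda>\<omega>. \<bar>grid_mean \<tau> B R m j \<omega>\<bar> powr p)"
    unfolding eq using sum(1) by simp
  then show ?int using integrable_tau[of "\<lambda>\<omega>. \<bar>grid_mean \<tau> B R m j \<omega>\<bar> powr p" x] by simp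
  have "sqrt (1 / 2) ^ m = t powr (- (1 / 2))"
    unfolding t_def by (rule sqrt_half_power)
  then have tp: "(sqrt (1 / 2) ^ m) powr p = t powr (p / 2) / t powr p"
    by (simp add: powr_powr flip: powr_diff)
  have "(LINT \<omega>|M. \<bar>grid_mean \<tau> B R m j (\<tau> x \<omega>)\<bar> powr p) = (LINT \<omega>|M. \<bar>grid_mean \<tau> B R m j \<omega>\<bar> powr p)"
    by (rule integral_tau[of "\<lambda>\<omega>. \<bar>grid_mean \<tau> B R m j \<omega>\<bar> powr p"]) measurable
  also have "\<dots> = (LINT \<omega>|M. \<bar>\<Sum>z\<in>grid R m. B (\<tau> z \<omega>) $ j\<bar> powr p) / t powr p"
    unfolding eq by simp
  also have "\<dots> \<le> ((moment_const p * t) powr (p / 2) * \<beta>) / t powr p"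
    using sum(2) by (intro divide_right_mono) (auto simp: card_grid[OF R] t_def \<beta>_def)
  also have "\<dots> = moment_const p powr (p / 2) * \<beta> * (sqrt (1 / 2) ^ m) powr p"
    unfolding tp by (simp add: powr_mult)
  finally show ?le by (simp add: \<beta>_def)
qed

end

text \<open>The hypotheses on the field, for a fixed range of dependence \<open>R\<close>.\<close>

locale decorrelated_field = random_environment M \<tau> A
  for M :: "'a measure" and \<tau> :: "real ^ 'n::finite \<Rightarrow> 'a \<Rightarrow> 'a" and A :: "'a \<Rightarrow> real ^ 'n ^ 'n" +
  fixes B :: "'a \<Rightarrow> real ^ 'n" and p R :: real
  assumes dim: "CARD('n) \<ge> 3" and p: "p \<ge> 2" and B_Lp: "B \<in> Lp M p" and B_mean: "(LINT \<omega>|M. B \<omega>) = 0"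
    and B_div: "\<forall>\<psi>\<in>test_functions M \<tau>. divergence M \<tau> B \<psi> = 0"
    and R: "R > 0" and frd: "finite_range_dependence M \<tau> B R"
begin

lemma B_measurable [measurable]: "B \<in> borel_measurable M"
  using B_Lp by (simp add: Lp_def)

lemma B_component_moment:
  "integrable M (\<lambda>\<omega>. \<bar>B \<omega> $ j\<bar> powr p)"
  "(LINT \<omega>|M. \<bar>B \<omega> $ j\<bar> powr p) \<le> (LINT \<omega>|M. norm (B \<omega>) powr p)"
proof -
  have int: "integrable M (\<lambda>\<omega>. norm (B \<omega>) powr p)" using B_Lp by (simp add: Lp_def)
  have le: "\<bar>B \<omega> $ j\<bar> powr p \<le> norm (B \<omega>) powr p" for \<omega>
    using p by (intro powr_mono2 component_le_norm_cart) auto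
  show i: "integrable M (\<lambda>\<omega>. \<bar>B \<omega> $ j\<bar> powr p)"
    by (rule Bochner_Integration.integrable_bound[OF int]) (use le in auto)
  show "(LINT \<omega>|M. \<bar>B \<omega> $ j\<bar> powr p) \<le> (LINT \<omega>|M. norm (B \<omega>) powr p)"
    by (intro integral_mono i int le)
qed

lemma B_component_square: "integrable M (\<lambda>\<omega>. (B \<omega> $ j)\<^sup>2)"
  using integrable_square_of_powr[OF prob_space_axioms _ B_component_moment(1) p] by simp

lemma B_component_mean: "(LINT \<omega>|M. B \<omega> $ j) = 0"
proof -
  have "integrable M (\<lambda>\<omega>. norm (B \<omega>))"
    using integrable_of_powr[OF prob_space_axioms, of "\<lambda>\<omega>. norm (B \<omega>)" p] B_Lp p by (simp add: Lp_def)
  then have "integrable M B" by (simp add: integrable_norm_iff)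
  then have "(LINT \<omega>|M. B \<omega> \<bullet> axis j 1) = (LINT \<omega>|M. B \<omega>) \<bullet> axis j 1"
    by (rule integral_inner_left)
  then show ?thesis using B_mean by (simp add: inner_axis)
qed

abbreviation "gm \<equiv> grid_mean \<tau> B R"

lemmas gm_moment = grid_mean_moment[OF B_measurable R frd p B_component_moment(1) B_component_mean]

text \<open>The constant in the bound on the \<open>p\<close>-th moment of the flux.\<close>

definition flux_const :: real
  where "flux_const = 2 * moment_const p powr (p / 2) * (LINT \<omega>|M. norm (B \<omega>) powr p) * R powr p"

lemma flux_moment:
  "integrable M (\<lambda>\<omega>. \<bar>flux \<tau> B R m j k s \<omega>\<bar> powr p)"
  "(LINT \<omega>|M. \<bar>flux \<tau> B R m j k s \<omega>\<bar> powr p) \<le> flux_const * ((2 powr (- 1 / 6)) ^ m) powr p"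
proof -
  define L where "L = grid_edge R TYPE('n) m"
  define v :: "real ^ 'n" where "v = s *\<^sub>R grid_step R m"
  define K where "K = moment_const p powr (p / 2) * (LINT \<omega>|M. norm (B \<omega>) powr p) * (sqrt (1 / 2) ^ m) powr p"
  define X where "X = (\<lambda>\<omega>. if j = grid_dir m then gm m k (\<tau> v \<omega>) else 0)"
  define Y where "Y = (\<lambda>\<omega>. if k = grid_dir m then gm m j (\<tau> v \<omega>) else 0)"
  have L0: "L > 0" using R by (simp add: L_def grid_edge_def)
  have [measurable]: "X \<in> borel_measurable M" "Y \<in> borel_measurable M" unfolding X_def Y_def by measurable
  have K0: "K \<ge> 0" by (simp add: K_def)
  have gmle: "(LINT \<omega>|M. \<bar>gm m i (\<tau> v \<omega>)\<bar> powr p) \<le> K" for i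
  proof -
    have "(LINT \<omega>|M. \<bar>gm m i (\<tau> v \<omega>)\<bar> powr p)
        \<le> moment_const p powr (p / 2) * (LINT \<omega>|M. \<bar>B \<omega> $ i\<bar> powr p) * (sqrt (1 / 2) ^ m) powr p"
      by (rule gm_moment)
    also have "\<dots> \<le> K" unfolding K_def
      by (intro mult_right_mono mult_left_mono B_component_moment) auto
    finally show ?thesis .
  qed
  have X: "integrable M (\<lambda>\<omega>. \<bar>X \<omega>\<bar> powr p)" "(LINT \<omega>|M. \<bar>X \<omega>\<bar> powr p) \<le> K"
    using gm_moment(1) gmle K0 by (cases "j = grid_dir m"; simp add: X_def)+
  have Y: "integrable M (\<lambda>\<omega>. \<bar>Y \<omega>\<bar> powr p)" "(LINT \<omega>|M. \<bar>Y \<omega>\<bar> powr p) \<le> K"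
    using gm_moment(1) gmle K0 by (cases "k = grid_dir m"; simp add: Y_def)+
  have le: "\<bar>flux \<tau> B R m j k s \<omega>\<bar> powr p \<le> L powr p * (\<bar>X \<omega>\<bar> powr p + \<bar>Y \<omega>\<bar> powr p)" for \<omega>
  proof -
    have fl: "flux \<tau> B R m j k s \<omega> = L / 2 * (X \<omega> + - Y \<omega>)"
      by (simp add: flux_def L_def X_def Y_def v_def)
    have "\<bar>flux \<tau> B R m j k s \<omega>\<bar> = L / 2 * \<bar>X \<omega> + - Y \<omega>\<bar>"
      unfolding fl abs_mult using L0 by simp
    then have "\<bar>flux \<tau> B R m j k s \<omega>\<bar> powr p = (L / 2) powr p * \<bar>X \<omega> + - Y \<omega>\<bar> powr p"
      by (simp only: powr_mult)
    also have "\<dots> \<le> (L / 2) powr p * (2 powr p * (\<bar>X \<omega>\<bar> powr p + \<bar>- Y \<omega>\<bar> powr p))"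
      using p by (intro mult_left_mono powr_add_le) auto
    also have "\<dots> = L powr p * (\<bar>X \<omega>\<bar> powr p + \<bar>Y \<omega>\<bar> powr p)"
      using L0 by (simp add: powr_divide)
    finally show ?thesis .
  qed
  have [measurable]: "flux \<tau> B R m j k s \<in> borel_measurable M"
    unfolding flux_def by measurable
  show i: "integrable M (\<lambda>\<omega>. \<bar>flux \<tau> B R m j k s \<omega>\<bar> powr p)"
    by (rule Bochner_Integration.integrable_bound[of M "\<lambda>\<omega>. L powr p * (\<bar>X \<omega>\<bar> powr p + \<bar>Y \<omega>\<bar> powr p)"])
       (use X Y le in auto)
  have "(LINT \<omega>|M. \<bar>flux \<tau> B R m j k s \<omega>\<bar> powr p) \<le> (LINT \<omega>|M. L powr p * (\<bar>X \<omega>\<bar> powr p + \<bar>Y \<omega>\<bar> powr p))"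
    using X Y by (intro integral_mono i le) auto
  also have "\<dots> \<le> L powr p * (K + K)" using X Y by (simp add: mult_left_mono add_mono)
  also have "\<dots> = 2 * moment_const p powr (p / 2) * (LINT \<omega>|M. norm (B \<omega>) powr p) * (L * sqrt (1 / 2) ^ m) powr p"
    using L0 by (simp add: K_def powr_mult)
  also have "\<dots> \<le> 2 * moment_const p powr (p / 2) * (LINT \<omega>|M. norm (B \<omega>) powr p) * (R * (2 powr (- 1 / 6)) ^ m) powr p"
    using p L0 edge_decay[OF dim R] by (intro mult_left_mono powr_mono2) (auto simp: L_def)
  also have "\<dots> = flux_const * ((2 powr (- 1 / 6)) ^ m) powr p"
    using R by (simp add: flux_const_def powr_mult)
  finally show "(LINT \<omega>|M. \<bar>flux \<tau> B R m j k s \<omega>\<bar> powr p) \<le> flux_const * ((2 powr (- 1 / 6)) ^ m) powr p" .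
qed

abbreviation "inc \<equiv> stream_increment \<tau> B R"

lemma flux_measurable [measurable]:
  "(\<lambda>(s, \<omega>). flux \<tau> B R m j k s \<omega>) \<in> borel_measurable (unit_measure \<Otimes>\<^sub>M M)"
  unfolding flux_def by measurable

lemmas inc_moment = averaged_moment[OF prob_space_unit_measure prob_space_axioms
  flux_measurable flux_moment(1) flux_moment(2) p, folded stream_increment_def]

lemma inc_measurable [measurable]: "inc m j k \<in> borel_measurable M"
  by (rule inc_moment(1))

lemma decay_rate_bounds: "0 < (2::real) powr (- 1 / 6)" "(2::real) powr (- 1 / 6) < 1"
  by (auto simp: powr_less_one)

lemma inc_moment_le:
  "(LINT \<omega>|M. \<bar>inc m j k \<omega>\<bar> powr p) \<le> (2 powr p * flux_const) * ((2 powr (- 1 / 6)) ^ m) powr p"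
  using inc_moment(3) by (simp add: mult.assoc)

lemmas stream_series = moment_series[OF prob_space_axioms inc_measurable inc_moment(2) inc_moment_le p decay_rate_bounds]

text \<open>The correlation of the translated field with a fixed function.\<close>

definition correlation :: "('a \<Rightarrow> real) \<Rightarrow> 'n \<Rightarrow> real ^ 'n \<Rightarrow> real"
  where "correlation \<psi> j x = (LINT \<omega>|M. B (\<tau> x \<omega>) $ j * \<psi> \<omega>)"

lemma gm_correlation:
  assumes [measurable]: "h \<in> borel_measurable M" and h: "integrable M (\<lambda>\<omega>. (h \<omega>)\<^sup>2)"
  shows "(LINT \<omega>|M. gm m j (\<tau> x \<omega>) * h \<omega>) = grid_avg R m (\<lambda>z. correlation h j (z + x))"
proof -
  have int: "integrable M (\<lambda>\<omega>. B (\<tau> y \<omega>) $ j * h \<omega>)" for y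
    using integrable_tau[of "\<lambda>\<omega>. (B \<omega> $ j)\<^sup>2" y] B_component_square[of j] h
    by (intro integrable_mult_of_squares) auto
  have "(LINT \<omega>|M. gm m j (\<tau> x \<omega>) * h \<omega>) = (LINT \<omega>|M. (\<Sum>z\<in>grid R m. B (\<tau> (z + x) \<omega>) $ j * h \<omega>) / 2 ^ m)"
    by (intro Bochner_Integration.integral_cong)
       (auto simp: grid_mean_def grid_avg_def tau_add sum_distrib_right)
  also have "\<dots> = (\<Sum>z\<in>grid R m. LINT \<omega>|M. B (\<tau> (z + x) \<omega>) $ j * h \<omega>) / 2 ^ m"
    using int by (subst integral_divide_zero) (simp add: Bochner_Integration.integral_sum)
  finally show ?thesis by (simp add: grid_avg_def correlation_def)
qed

lemma gm_divergence_free: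
  assumes \<psi>: "\<psi> \<in> test_functions M \<tau>"
  shows "(\<Sum>k\<in>UNIV. LINT \<omega>|M. gm m k (\<tau> x \<omega>) * horizontal_derivative M \<tau> k \<psi> \<omega>) = 0"
proof -
  note G = has_horizontal_derivativeD[OF test_function_has_horizontal_derivative[OF \<psi>]]
  have "(\<Sum>k\<in>UNIV. LINT \<omega>|M. gm m k (\<tau> x \<omega>) * horizontal_derivative M \<tau> k \<psi> \<omega>)
      = (\<Sum>k\<in>UNIV. \<Sum>z\<in>grid R m. correlation (horizontal_derivative M \<tau> k \<psi>) k (z + x)) / 2 ^ m"
    using G by (simp add: gm_correlation grid_avg_def sum_divide_distrib)
  also have "\<dots> = (\<Sum>z\<in>grid R m. \<Sum>k\<in>UNIV. correlation (horizontal_derivative M \<tau> k \<psi>) k (z + x)) / 2 ^ m"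
    by (subst sum.swap) simp
  also have "\<dots> = 0"
    using divergence_free_shift[OF B_measurable B_div \<psi>] by (simp add: correlation_def)
  finally show ?thesis .
qed

text \<open>Tested against \<open>\<psi>\<close>, the divergence of the \<open>m\<close>-th increment is the decrease of the averaged
  correlation in step \<open>m\<close>, by the fundamental theorem of calculus along the segment.\<close>

lemma inc_divergence:
  assumes \<psi>: "\<psi> \<in> test_functions M \<tau>"
  shows "- (\<Sum>k\<in>UNIV. LINT \<omega>|M. inc m j k \<omega> * horizontal_derivative M \<tau> k \<psi> \<omega>)
    = grid_avg R m (correlation \<psi> j) - grid_avg R (Suc m) (correlation \<psi> j)"
proof -
  define D where "D = (\<lambda>k. horizontal_derivative M \<tau> k \<psi>)"
  define i :: 'n where "i = grid_dir m"
  define L where "L = grid_edge R TYPE('n) m"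
  define v :: "real ^ 'n" where "v = grid_step R m"
  have D: "has_horizontal_derivative M \<tau> k \<psi> (D k)" for k
    unfolding D_def by (rule test_function_has_horizontal_derivative[OF \<psi>])
  note G = has_horizontal_derivativeD[OF D]
  note [measurable] = G(1,2)
  have dom: "integrable unit_measure (\<lambda>s. LINT \<omega>|M. flux \<tau> B R m j k s \<omega> * D k \<omega>)"
    "(LINT \<omega>|M. inc m j k \<omega> * D k \<omega>) = (LINT s|unit_measure. LINT \<omega>|M. flux \<tau> B R m j k s \<omega> * D k \<omega>)" for k
    using inc_moment(4)[OF G(2,4)] by auto
  \<comment> \<open>\<open>F 1 - F 0\<close> is the right-hand side, since a doubled box averages the box and its translate.\<close>
  define F where "F = (\<lambda>s. - (grid_avg R m (\<lambda>z. correlation \<psi> j (z + s *\<^sub>R v))) / 2)"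
  \<comment> \<open>The terms with a free summation index \<open>k\<close> cancel because the field is divergence free.\<close>
  have flux: "- (\<Sum>k\<in>UNIV. LINT \<omega>|M. flux \<tau> B R m j k s \<omega> * D k \<omega>)
      = L / 2 * (LINT \<omega>|M. gm m j (\<tau> (s *\<^sub>R v) \<omega>) * D i \<omega>)" for s
  proof -
    have int: "integrable M (\<lambda>\<omega>. gm m l (\<tau> (s *\<^sub>R v) \<omega>) * D k \<omega>)" for k l
      by (intro integrable_mult_of_squares integrable_square_of_powr[OF prob_space_axioms _ gm_moment(1) p] G)
        measurable
    have fl: "(LINT \<omega>|M. flux \<tau> B R m j k s \<omega> * D k \<omega>)
      = L / 2 * ((if j = i then (LINT \<omega>|M. gm m k (\<tau> (s *\<^sub>R v) \<omega>) * D k \<omega>) else 0)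
        - (if k = i then (LINT \<omega>|M. gm m j (\<tau> (s *\<^sub>R v) \<omega>) * D k \<omega>) else 0))" for k
      using int[of k k] int[of j k]
      by (simp add: flux_def L_def i_def v_def left_diff_distrib right_diff_distrib mult.assoc)
    have "(\<Sum>k\<in>UNIV. LINT \<omega>|M. flux \<tau> B R m j k s \<omega> * D k \<omega>)
      = L / 2 * ((if j = i then (\<Sum>k\<in>UNIV. LINT \<omega>|M. gm m k (\<tau> (s *\<^sub>R v) \<omega>) * D k \<omega>) else 0)
        - (LINT \<omega>|M. gm m j (\<tau> (s *\<^sub>R v) \<omega>) * D i \<omega>))"
      unfolding fl sum_distrib_left[symmetric] sum_subtractf by simp
    also have "(\<Sum>k\<in>UNIV. LINT \<omega>|M. gm m k (\<tau> (s *\<^sub>R v) \<omega>) * D k \<omega>) = 0"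
      unfolding D_def by (rule gm_divergence_free[OF \<psi>])
    finally show ?thesis by simp
  qed
  have deriv: "(F has_real_derivative L / 2 * (LINT \<omega>|M. gm m j (\<tau> (s *\<^sub>R v) \<omega>) * D i \<omega>)) (at s)" for s
  proof -
    have c: "((\<lambda>s. correlation \<psi> j (z + s *\<^sub>R v)) has_real_derivative - L * correlation (D i) j (z + s *\<^sub>R v)) (at s)" for z
    proof -
      have "((\<lambda>t. correlation \<psi> j (z + t *\<^sub>R axis i 1)) has_real_derivative
          - correlation (D i) j (z + (L * s) *\<^sub>R axis i 1)) (at (L * s))"
        unfolding correlation_def
        by (rule correlation_has_derivative[OF D, of "\<lambda>\<omega>. B \<omega> $ j"]) (use B_component_square in auto)
      from DERIV_chain2[OF this DERIV_cmult_Id[of L s UNIV]]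
      show ?thesis by (simp add: v_def grid_step_def L_def i_def mult.commute)
    qed
    have "(F has_real_derivative - ((\<Sum>z\<in>grid R m. - L * correlation (D i) j (z + s *\<^sub>R v)) / 2 ^ m) / 2) (at s)"
      unfolding F_def grid_avg_def
      by (intro DERIV_cdivide DERIV_minus DERIV_sum c)
    moreover have "- ((\<Sum>z\<in>grid R m. - L * correlation (D i) j (z + s *\<^sub>R v)) / 2 ^ m) / 2
        = L / 2 * grid_avg R m (\<lambda>z. correlation (D i) j (z + s *\<^sub>R v))"
      by (simp add: grid_avg_def sum_negf flip: sum_distrib_left)
    ultimately show ?thesis unfolding gm_correlation[OF G(2,4)] by (simp only:)
  qed
  have "- (\<Sum>k\<in>UNIV. LINT \<omega>|M. inc m j k \<omega> * D k \<omega>)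
      = (LINT s|unit_measure. - (\<Sum>k\<in>UNIV. LINT \<omega>|M. flux \<tau> B R m j k s \<omega> * D k \<omega>))"
    using dom by (simp add: Bochner_Integration.integral_sum)
  also have "\<dots> = F 1 - F 0"
  proof (rule unit_measure_FTC)
    show "integrable unit_measure (\<lambda>s. - (\<Sum>k\<in>UNIV. LINT \<omega>|M. flux \<tau> B R m j k s \<omega> * D k \<omega>))"
      using dom by (intro Bochner_Integration.integrable_minus Bochner_Integration.integrable_sum) auto
  qed (unfold flux, rule deriv)
  also have "\<dots> = grid_avg R m (correlation \<psi> j) - grid_avg R (Suc m) (correlation \<psi> j)"
    by (simp add: F_def v_def grid_avg_Suc[OF R] field_simps)
  finally show ?thesis by (simp add: D_def)
qed

text \<open>The averages of the field over the boxes tend to its mean 0 in \<open>L\<^sup>2\<close>.\<close>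

lemma grid_avg_correlation_tendsto_0:
  assumes [measurable]: "\<psi> \<in> borel_measurable M" and \<psi>: "integrable M (\<lambda>\<omega>. (\<psi> \<omega>)\<^sup>2)"
  shows "(\<lambda>m. grid_avg R m (correlation \<psi> j)) \<longlonglongrightarrow> 0"
proof (rule Lim_null_comparison)
  define K where "K = moment_const 2 * (LINT \<omega>|M. (B \<omega> $ j)\<^sup>2)"
  have int2: "integrable M (\<lambda>\<omega>. \<bar>B \<omega> $ j\<bar> powr 2)"
    using B_component_square[of j] by (simp add: powr_numeral)
  note mom = grid_mean_moment[OF B_measurable R frd order_refl int2 B_component_mean]
  have sq: "integrable M (\<lambda>\<omega>. (gm m j \<omega>)\<^sup>2)" "(LINT \<omega>|M. (gm m j \<omega>)\<^sup>2) \<le> K * (1 / 2) ^ m" for m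
  proof -
    have eq: "(LINT \<omega>|M. (gm m j (\<tau> 0 \<omega>))\<^sup>2) = (LINT \<omega>|M. (gm m j \<omega>)\<^sup>2)"
      by (rule integral_tau) measurable
    have pw: "(sqrt (1 / 2) ^ m)\<^sup>2 = (1 / 2 :: real) ^ m"
      by (simp add: power_mult[symmetric] mult.commute[of m] power_mult)
    show "integrable M (\<lambda>\<omega>. (gm m j \<omega>)\<^sup>2)"
      using mom(1)[of m 0] integrable_tau[of "\<lambda>\<omega>. (gm m j \<omega>)\<^sup>2" 0] by (simp add: powr_numeral)
    show "(LINT \<omega>|M. (gm m j \<omega>)\<^sup>2) \<le> K * (1 / 2) ^ m"
      using mom(2)[of m 0] moment_const_ge_1[of 2]
      by (simp add: powr_numeral eq pw K_def)
  qed
  show "\<forall>\<^sub>F m in sequentially. norm (grid_avg R m (correlation \<psi> j))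
      \<le> ((LINT \<omega>|M. (\<psi> \<omega>)\<^sup>2) + 1) * sqrt (K * (1 / 2) ^ m)"
  proof (intro always_eventually allI)
    fix m
    have "grid_avg R m (correlation \<psi> j) = (LINT \<omega>|M. gm m j (\<tau> 0 \<omega>) * \<psi> \<omega>)"
      using gm_correlation[OF assms, of m j 0] by simp
    also have "\<dots> = (LINT \<omega>|M. \<psi> \<omega> * gm m j \<omega>)"
      by (intro Bochner_Integration.integral_cong) (auto simp: tau_zero)
    finally have "\<bar>grid_avg R m (correlation \<psi> j)\<bar>
        \<le> ((LINT \<omega>|M. (\<psi> \<omega>)\<^sup>2) + 1) * sqrt (LINT \<omega>|M. (gm m j \<omega>)\<^sup>2)"
      using abs_integral_mult_le[OF _ _ \<psi> sq(1)[of m]] by simp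
    also have "\<dots> \<le> ((LINT \<omega>|M. (\<psi> \<omega>)\<^sup>2) + 1) * sqrt (K * (1 / 2) ^ m)"
      using sq(2) by (intro mult_left_mono) (auto intro!: add_nonneg_nonneg)
    finally show "norm (grid_avg R m (correlation \<psi> j)) \<le> \<dots>" by simp
  qed
  have "(\<lambda>m. (1 / 2 :: real) ^ m) \<longlonglongrightarrow> 0" by (rule LIMSEQ_power_zero) simp
  then have "(\<lambda>m. K * (1 / 2) ^ m) \<longlonglongrightarrow> 0" by (rule tendsto_mult_right_zero)
  from tendsto_real_sqrt[OF this]
  have "(\<lambda>m. sqrt (K * (1 / 2) ^ m)) \<longlonglongrightarrow> 0" by simp
  then show "(\<lambda>m. ((LINT \<omega>|M. (\<psi> \<omega>)\<^sup>2) + 1) * sqrt (K * (1 / 2) ^ m)) \<longlonglongrightarrow> 0"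
    by (rule tendsto_mult_right_zero)
qed

text \<open>Where one of the series diverges, which happens on a null set only, \<open>suminf\<close> is a default value.\<close>

definition stream_matrix :: "'a \<Rightarrow> real ^ 'n ^ 'n"
  where "stream_matrix \<omega> = (\<chi> j k. \<Sum>m. inc m j k \<omega>)"

lemma stream_matrix_Lp: "stream_matrix \<in> Lp M p"
proof -
  have [measurable]: "(\<lambda>\<omega>. stream_matrix \<omega> $ j $ k) \<in> borel_measurable M" for j k
    unfolding stream_matrix_def by simp
  have meas [measurable]: "stream_matrix \<in> borel_measurable M"
  proof (subst borel_measurable_euclidean_space, intro ballI)
    fix b :: "real ^ 'n ^ 'n" assume "b \<in> Basis"
    then obtain j k where b: "b = axis j (axis k 1)" by (auto simp: Basis_vec_def)
    show "(\<lambda>\<omega>. stream_matrix \<omega> \<bullet> b) \<in> borel_measurable M"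
      unfolding b by (simp add: inner_axis)
  qed
  have sum: "integrable M (\<lambda>\<omega>. \<bar>\<Sum>x\<in>I. f x \<omega>\<bar> powr p)"
    if "finite I" "\<And>x. x \<in> I \<Longrightarrow> integrable M (\<lambda>\<omega>. \<bar>f x \<omega>\<bar> powr p)"
      and f: "\<And>x. f x \<in> borel_measurable M" for I :: "('n \<times> 'n) set" and f :: "'n \<times> 'n \<Rightarrow> 'a \<Rightarrow> real"
    using that(1,2)
  proof (induction I rule: finite_induct)
    case (insert x I)
    then show ?case
      using f p by (simp add: integrable_powr_add)
  qed (use p in simp)
  let ?s = "\<lambda>\<omega>. \<Sum>(j, k)\<in>UNIV. \<bar>stream_matrix \<omega> $ j $ k\<bar>"
  have int: "integrable M (\<lambda>\<omega>. \<bar>?s \<omega>\<bar> powr p)"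
    using sum[of UNIV "\<lambda>(j, k) \<omega>. \<bar>stream_matrix \<omega> $ j $ k\<bar>"] stream_series(2)
    by (simp add: case_prod_unfold stream_matrix_def)
  have le: "norm (stream_matrix \<omega>) \<le> ?s \<omega>" for \<omega>
  proof -
    have "norm (stream_matrix \<omega>) \<le> (\<Sum>j\<in>UNIV. norm (stream_matrix \<omega> $ j))"
      by (simp add: norm_vec_def L2_set_le_sum)
    also have "\<dots> \<le> (\<Sum>j\<in>UNIV. \<Sum>k\<in>UNIV. \<bar>stream_matrix \<omega> $ j $ k\<bar>)"
      by (intro sum_mono norm_le_l1_cart)
    also have "\<dots> = ?s \<omega>" by (simp add: sum.cartesian_product)
    finally show ?thesis .
  qed
  have pt: "norm (stream_matrix \<omega>) powr p \<le> \<bar>?s \<omega>\<bar> powr p" for \<omega>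
    by (rule powr_mono2[OF _ _ order_trans[OF le abs_ge_self]]) (use p in simp_all)
  have "integrable M (\<lambda>\<omega>. norm (stream_matrix \<omega>) powr p)"
    by (rule Bochner_Integration.integrable_bound[OF int]) (use pt in simp_all)
  then show ?thesis by (simp add: Lp_def)
qed

lemma stream_matrix_skew: "AE \<omega> in M. transpose (stream_matrix \<omega>) = - stream_matrix \<omega>"
proof -
  have "AE \<omega> in M. \<forall>j k. summable (\<lambda>m. inc m j k \<omega>)"
    using stream_series(1) by (simp add: AE_all_countable)
  then show ?thesis
  proof eventually_elim
    case (elim \<omega>)
    have sk: "(\<Sum>m. inc m k j \<omega>) = - (\<Sum>m. inc m j k \<omega>)" for j k
      unfolding stream_increment_skew[of \<tau> B R _ k j] by (rule suminf_minus) (use elim in blast)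
    have "transpose (stream_matrix \<omega>) $ j $ k = (- stream_matrix \<omega>) $ j $ k" for j k
      using sk[of k j] by (simp add: transpose_def stream_matrix_def)
    then show ?case unfolding vec_eq_iff by blast
  qed
qed

lemma stream_matrix_divergence:
  assumes \<psi>: "\<psi> \<in> test_functions M \<tau>"
  shows "matrix_divergence M \<tau> stream_matrix j \<psi> = (LINT \<omega>|M. B \<omega> $ j * \<psi> \<omega>)"
proof -
  note G = has_horizontal_derivativeD[OF test_function_has_horizontal_derivative[OF \<psi>]]
  have "(\<lambda>m. - (\<Sum>k\<in>UNIV. LINT \<omega>|M. inc m j k \<omega> * horizontal_derivative M \<tau> k \<psi> \<omega>)) sums
      - (\<Sum>k\<in>UNIV. LINT \<omega>|M. (\<Sum>m. inc m j k \<omega>) * horizontal_derivative M \<tau> k \<psi> \<omega>)"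
    by (intro sums_minus sums_sum stream_series(3) G)
  moreover have "(\<lambda>m. grid_avg R m (correlation \<psi> j) - grid_avg R (Suc m) (correlation \<psi> j)) sums
      (grid_avg R 0 (correlation \<psi> j) - 0)"
    by (rule telescope_sums'[OF grid_avg_correlation_tendsto_0[OF G(1,3)]])
  ultimately have "- (\<Sum>k\<in>UNIV. LINT \<omega>|M. (\<Sum>m. inc m j k \<omega>) * horizontal_derivative M \<tau> k \<psi> \<omega>)
      = correlation \<psi> j 0"
    unfolding inc_divergence[OF \<psi>] grid_avg_0 by (simp add: sums_unique2)
  also have "correlation \<psi> j 0 = (LINT \<omega>|M. B \<omega> $ j * \<psi> \<omega>)"
    unfolding correlation_def by (intro Bochner_Integration.integral_cong) (auto simp: tau_zero)
  finally show ?thesis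
    by (simp add: matrix_divergence_def dist_derivative_def stream_matrix_def sum_negf)
qed

end

theorem proposition2p6:
  fixes M :: "'a measure"
    and \<tau> :: "real ^ 'n::finite \<Rightarrow> 'a \<Rightarrow> 'a"
    and A :: "'a \<Rightarrow> real ^ 'n ^ 'n"
    and B :: "'a \<Rightarrow> real ^ 'n"
    and p :: real
  assumes "random_environment M \<tau> A"
    and "CARD('n) \<ge> 3"
    and "p \<ge> 2"
    and "B \<in> Lp M p"
    and "(LINT \<omega>|M. B \<omega>) = 0"
    and "\<forall>\<psi>\<in>test_functions M \<tau>. divergence M \<tau> B \<psi> = 0"
    and "\<exists>R>0. finite_range_dependence M \<tau> B R"
  shows "\<exists>S :: 'a \<Rightarrow> real ^ 'n ^ 'n. S \<in> Lp M p \<and>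
    (AE \<omega> in M. transpose (S \<omega>) = - S \<omega>) \<and>
    (\<forall>j. \<forall>\<psi>\<in>test_functions M \<tau>. matrix_divergence M \<tau> S j \<psi> = (LINT \<omega>|M. B \<omega> $ j * \<psi> \<omega>))"
proof -
  obtain R where "R > 0" "finite_range_dependence M \<tau> B R" using assms(7) by blast
  then interpret decorrelated_field M \<tau> A B p R
    using assms(1-6) by (intro decorrelated_field.intro decorrelated_field_axioms.intro)
  show ?thesis
    using stream_matrix_Lp stream_matrix_skew stream_matrix_divergence by blast
qed

end
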